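(* Let $0<T_1<\cdots<T_m\le1$, $c=(c_1,\ldots,c_m)\in\mathbb{R}^m$, and $$L_T(c)=\{h\in\mathcal{H}_0:h(T_1)=c_1,\ldots,h(T_m)=c_m\},$$ a closed affine subspace of the Cameron-Martin space $\mathcal{H}_0$ of classical Wiener space $(\mathcal{C}_0,\mu)$. Let $h\in\mathcal{H}_0$ and $f=\dot h$, and write $\int_0^1f(t)\,dB_t$ for the random variable $I_{L_T(c)}(h)\in L^2(\mathcal{C}_0,\mu_{L_T(c)})$. Then $$\mathbb{E}_{\mu_{L_T(c)}}\Bigl(\int_0^1f(t)\,dB_t\Bigr)=\frac{c_1}{T_1}\int_0^{T_1}f(t)\,dt+\sum_{k=2}^m\frac{c_k-c_{k-1}}{T_k-T_{k-1}}\int_{T_{k-1}}^{T_k}f(t)\,dt.$$ In particular, when $h\in\mathcal{H}_{\mathcal{C}_0^*}$, the Gaussian Radon transform $GI(h)|_{L_T(c)}$ equals the right-hand side.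
   Context: Classical Wiener space: $\mathcal{C}_0$ is the Banach space (sup norm) of continuous functions $\omega:[0,1]\to\mathbb{R}$ with $\omega(0)=0$; $\mu$ is standard Wiener measure on $\mathcal{C}_0$; $B_t(\omega)=\omega(t)$ is standard Brownian motion under $\mu$. $\mathcal{H}_0$ is the Hilbert space of absolutely continuous $h:[0,1]\to\mathbb{R}$ with $h(0)=0$ and $\int_0^1\dot h(t)^2dt<\infty$, with inner product $\langle h,k\rangle=\int_0^1\dot h(t)\dot k(t)\,dt$. $I:\mathcal{H}_0\to L^2(\mathcal{C}_0,\mu)$ is the isometry $I(h)=\int_0^1\dot h(t)\,dB_t$ (Wiener integral). $\mathcal{H}_{\mathcal{C}_0^*}=\{h\in\mathcal{H}_0:I(h)\in\mathcal{C}_0^*\}$, i.e. those $h$ for which $I(h)$ is ($\mu$-a.e. equal to) a continuous linear functional on $\mathcal{C}_0$; for such $h$, $I(h)$ always denotes this continuous functional. $\mathcal{H}_{\mathcal{C}_0^*}$ is dense in $\mathcal{H}_0$. Conditioned measure and Gaussian Radon transform: for a closed affine subspace $L\subset\mathcal{H}_0$, let $h_L$ be the point of $L$ closest to $0$, $L_0=L-h_L$, and $P_{L_0}$ the orthogonal projection of $\mathcal{H}_0$ onto $L_0$. $\mu_L$ is the Borel probability measure on $\mathcal{C}_0$ with $$\int_{\mathcal{C}_0}e^{iI(h)}\,d\mu_L=e^{i\langle h_L,h\rangle-\frac12\|P_{L_0}h\|^2}\qquad\text{for all }h\in\mathcal{H}_{\mathcal{C}_0^*}$$ (its existence is known). The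 map $\mathcal{H}_{\mathcal{C}_0^*}\to L^2(\mathcal{C}_0,\mu_L)$, $h\mapsto I(h)$, is linear and continuous for the norm of $\mathcal{H}_0$, and $I_L:\mathcal{H}_0\to L^2(\mathcal{C}_0,\mu_L)$ denotes its unique continuous linear extension. For a (pointwise defined) measurable function $\phi$ on $\mathcal{C}_0$, the Gaussian Radon transform is $G\phi|_L=\int_{\mathcal{C}_0}\phi\,d\mu_L$ whenever this integral is finite. $\mathbb{E}_{\mu_L}$ denotes expectation with respect to $\mu_L$. *)

theory Defs
  imports "HOL-Probability.Probability"
begin

section \<open>The space of continuous paths\<close>

text \<open>
  Functions on \<open>[0,1]\<close> are represented by functions on the reals that vanish off \<open>[0,1]\<close>,
  so that equality on \<open>[0,1]\<close> is equality.
\<close>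

typedef wiener_space =
  "{\<omega> :: real \<Rightarrow> real. continuous_on {0..1} \<omega> \<and> \<omega> 0 = 0 \<and> (\<forall>t. t \<notin> {0..1} \<longrightarrow> \<omega> t = 0)}"
  morphisms path_fun Abs_path
  by (rule exI[of _ "\<lambda>_. 0"]) auto

setup_lifting type_definition_wiener_space

lemma path_continuous: "continuous_on {0..1} (path_fun \<omega>)"
  and path_0: "path_fun \<omega> 0 = 0"
  and path_outside: "t \<notin> {0..1} \<Longrightarrow> path_fun \<omega> t = 0"
  using path_fun[of \<omega>] by auto

lemma path_bdd_above: "bdd_above ((\<lambda>t. \<bar>path_fun \<omega> t\<bar>) ` {0..1})"
proof -
  have "compact ((\<lambda>t. \<bar>path_fun \<omega> t\<bar>) ` {0..1})"
    by (intro compact_continuous_image continuous_intros path_continuous) auto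
  then show ?thesis
    by (intro bounded_imp_bdd_above compact_imp_bounded)
qed

instantiation wiener_space :: real_normed_vector
begin

lift_definition zero_wiener_space :: wiener_space is "\<lambda>_. 0"
  by simp

lift_definition plus_wiener_space :: "wiener_space \<Rightarrow> wiener_space \<Rightarrow> wiener_space"
  is "\<lambda>f g t. f t + g t"
  by (auto intro: continuous_intros)

lift_definition uminus_wiener_space :: "wiener_space \<Rightarrow> wiener_space"
  is "\<lambda>f t. - f t"
  by (auto intro: continuous_intros)

lift_definition minus_wiener_space :: "wiener_space \<Rightarrow> wiener_space \<Rightarrow> wiener_space"
  is "\<lambda>f g t. f t - g t"
  by (auto intro: continuous_intros)

lift_definition scaleR_wiener_space :: "real \<Rightarrow> wiener_space \<Rightarrow> wiener_space"
  is "\<lambda>c f t. c * f t"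
  by (auto intro: continuous_intros)

definition norm_wiener_space :: "wiener_space \<Rightarrow> real"
  where "norm_wiener_space \<omega> = (SUP t\<in>{0..1}. \<bar>path_fun \<omega> t\<bar>)"

definition dist_wiener_space :: "wiener_space \<Rightarrow> wiener_space \<Rightarrow> real"
  where "dist_wiener_space \<omega> \<eta> = norm (\<omega> - \<eta>)"

definition sgn_wiener_space :: "wiener_space \<Rightarrow> wiener_space"
  where "sgn_wiener_space \<omega> = inverse (norm \<omega>) *\<^sub>R \<omega>"

definition uniformity_wiener_space :: "(wiener_space \<times> wiener_space) filter"
  where "uniformity_wiener_space = (INF e\<in>{0<..}. principal {(\<omega>, \<eta>). dist \<omega> \<eta> < e})"

definition open_wiener_space :: "wiener_space set \<Rightarrow> bool"
  where "open_wiener_space U =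
    (\<forall>\<omega>\<in>U. eventually (\<lambda>(\<omega>', \<eta>). \<omega>' = \<omega> \<longrightarrow> \<eta> \<in> U) uniformity)"

instance
proof
  fix a b :: real and x y z :: wiener_space
  show "x + y + z = x + (y + z)" by transfer (simp add: algebra_simps)
  show "x + y = y + x" by transfer (simp add: algebra_simps)
  show "0 + x = x" by transfer simp
  show "- x + x = 0" by transfer simp
  show "x - y = x + - y" by transfer simp
  show "a *\<^sub>R (x + y) = a *\<^sub>R x + a *\<^sub>R y" by transfer (simp add: algebra_simps)
  show "(a + b) *\<^sub>R x = a *\<^sub>R x + b *\<^sub>R x" by transfer (simp add: algebra_simps)
  show "a *\<^sub>R b *\<^sub>R x = (a * b) *\<^sub>R x" by transfer (simp add: algebra_simps)
  show "1 *\<^sub>R x = x" by transfer simp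
  show "dist x y = norm (x - y)" by (rule dist_wiener_space_def)
  show "sgn x = inverse (norm x) *\<^sub>R x" by (rule sgn_wiener_space_def)
  show "uniformity = (INF e\<in>{0<..}. principal {(x :: wiener_space, y). dist x y < e})"
    by (rule uniformity_wiener_space_def)
  fix U :: "wiener_space set"
  show "open U = (\<forall>x\<in>U. eventually (\<lambda>(x', y). x' = x \<longrightarrow> y \<in> U) uniformity)"
    by (rule open_wiener_space_def)
next
  fix a :: real and x y :: wiener_space
  have le: "\<bar>path_fun z t\<bar> \<le> norm z" if "t \<in> {0..1}" for z :: wiener_space and t
    unfolding norm_wiener_space_def using that path_bdd_above by (rule cSUP_upper)
  show "norm (x + y) \<le> norm x + norm y"
    unfolding norm_wiener_space_def[of "x + y"]
  proof (rule cSUP_least)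
    fix t :: real assume t: "t \<in> {0..1}"
    have "path_fun (x + y) t = path_fun x t + path_fun y t" by transfer simp
    then show "\<bar>path_fun (x + y) t\<bar> \<le> norm x + norm y"
      using le[OF t, of x] le[OF t, of y] by linarith
  qed simp
  have scale: "norm (b *\<^sub>R z) \<le> \<bar>b\<bar> * norm z" for b and z :: wiener_space
    unfolding norm_wiener_space_def[of "b *\<^sub>R z"]
  proof (rule cSUP_least)
    fix t :: real assume t: "t \<in> {0..1}"
    have "path_fun (b *\<^sub>R z) t = b * path_fun z t" by transfer simp
    then show "\<bar>path_fun (b *\<^sub>R z) t\<bar> \<le> \<bar>b\<bar> * norm z"
      using le[OF t, of z] by (simp add: abs_mult mult_left_mono)
  qed simp
  show "norm (a *\<^sub>R x) = \<bar>a\<bar> * norm x"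
  proof (cases "a = 0")
    case True
    have "path_fun (0 *\<^sub>R x) t = 0" for t by transfer simp
    then have "norm (0 *\<^sub>R x) = 0" unfolding norm_wiener_space_def by simp
    with True show ?thesis by simp
  next
    case False
    have "inverse a *\<^sub>R a *\<^sub>R x = x"
      using False by transfer (simp add: field_simps)
    then have "norm x \<le> \<bar>inverse a\<bar> * norm (a *\<^sub>R x)"
      using scale[of "inverse a" "a *\<^sub>R x"] by simp
    then have "\<bar>a\<bar> * norm x \<le> norm (a *\<^sub>R x)"
      using False by (simp add: field_simps)
    with scale[of a x] show ?thesis by simp
  qed
  show "(norm x = 0) = (x = 0)"
  proof
    assume "norm x = 0"
    then have "path_fun x t = 0" if "t \<in> {0..1}" for t
      using le[OF that, of x] by simp
    then have "path_fun x t = 0" for t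
      using path_outside[of t x] by blast
    then show "x = 0"
      by transfer auto
  next
    assume "x = 0"
    moreover have "path_fun 0 t = 0" for t by transfer simp
    ultimately show "norm x = 0" unfolding norm_wiener_space_def by simp
  qed
qed

end


section \<open>The Cameron--Martin space\<close>

definition square_integrable :: "'a measure \<Rightarrow> ('a \<Rightarrow> real) \<Rightarrow> bool"
  where "square_integrable M f \<longleftrightarrow> f \<in> borel_measurable M \<and> integrable M (\<lambda>x. (f x)\<^sup>2)"

lemma square_integrable_mult:
  assumes "square_integrable M f" "square_integrable M g"
  shows "integrable M (\<lambda>x. f x * g x)"
proof (rule Bochner_Integration.integrable_bound)
  show "integrable M (\<lambda>x. (f x)\<^sup>2 + (g x)\<^sup>2)"
    using assms unfolding square_integrable_def by auto
  show "(\<lambda>x. f x * g x) \<in> borel_measurable M"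
    using assms unfolding square_integrable_def by auto
  have "\<bar>a * b\<bar> \<le> a\<^sup>2 + b\<^sup>2" for a b :: real
  proof -
    have "2 * (\<bar>a\<bar> * \<bar>b\<bar>) \<le> a\<^sup>2 + b\<^sup>2"
      using sum_squares_bound[of "\<bar>a\<bar>" "\<bar>b\<bar>"] by simp
    moreover have "0 \<le> \<bar>a\<bar> * \<bar>b\<bar>" by simp
    ultimately show ?thesis by (simp only: abs_mult)
  qed
  then show "AE x in M. norm (f x * g x) \<le> norm ((f x)\<^sup>2 + (g x)\<^sup>2)"
    by simp
qed

lemma square_integrable_add:
  assumes "square_integrable M f" "square_integrable M g"
  shows "square_integrable M (\<lambda>x. f x + g x)"
  using assms square_integrable_mult[OF assms]
  unfolding square_integrable_def power2_sum by (auto simp: mult.assoc)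

lemma square_integrable_scale:
  assumes "square_integrable M f"
  shows "square_integrable M (\<lambda>x. c * f x)"
  using assms unfolding square_integrable_def power_mult_distrib by auto

definition abs_cont_on :: "real \<Rightarrow> real \<Rightarrow> (real \<Rightarrow> real) \<Rightarrow> bool"
  where "abs_cont_on a b f \<longleftrightarrow>
    (\<forall>\<epsilon>>0. \<exists>\<delta>>0. \<forall>D. D division_of \<Union>D \<and> \<Union>D \<subseteq> {a..b} \<and> (\<Sum>K\<in>D. Sup K - Inf K) < \<delta>
      \<longrightarrow> (\<Sum>K\<in>D. \<bar>f (Sup K) - f (Inf K)\<bar>) < \<epsilon>)"

lemma abs_cont_on_0: "abs_cont_on a b (\<lambda>_. 0)"
  unfolding abs_cont_on_def by (auto intro: exI[of _ 1])

lemma abs_cont_on_scale: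
  assumes "abs_cont_on a b f"
  shows "abs_cont_on a b (\<lambda>t. c * f t)"
  unfolding abs_cont_on_def
proof (intro allI impI)
  fix \<epsilon> :: real assume "\<epsilon> > 0"
  then have "\<epsilon> / (\<bar>c\<bar> + 1) > 0" by simp
  then obtain \<delta> where \<delta>: "\<delta> > 0" "\<And>D. D division_of \<Union>D \<Longrightarrow> \<Union>D \<subseteq> {a..b} \<Longrightarrow>
      (\<Sum>K\<in>D. Sup K - Inf K) < \<delta> \<Longrightarrow> (\<Sum>K\<in>D. \<bar>f (Sup K) - f (Inf K)\<bar>) < \<epsilon> / (\<bar>c\<bar> + 1)"
    using assms unfolding abs_cont_on_def by meson
  have "(\<Sum>K\<in>D. \<bar>c * f (Sup K) - c * f (Inf K)\<bar>) < \<epsilon>"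
    if D: "D division_of \<Union>D" "\<Union>D \<subseteq> {a..b}" "(\<Sum>K\<in>D. Sup K - Inf K) < \<delta>" for D
  proof -
    let ?S = "\<Sum>K\<in>D. \<bar>f (Sup K) - f (Inf K)\<bar>"
    have "(\<Sum>K\<in>D. \<bar>c * f (Sup K) - c * f (Inf K)\<bar>) = \<bar>c\<bar> * ?S"
      unfolding sum_distrib_left right_diff_distrib[symmetric] abs_mult ..
    also have "\<dots> \<le> (\<bar>c\<bar> + 1) * ?S"
      by (intro mult_right_mono sum_nonneg) auto
    also have "\<dots> < \<epsilon>"
      using \<delta>(2)[OF D] by (simp add: pos_less_divide_eq mult.commute add_pos_nonneg)
    finally show ?thesis .
  qed
  with \<delta>(1) show "\<exists>\<delta>>0. \<forall>D. D division_of \<Union>D \<and> \<Union>D \<subseteq> {a..b} \<and> (\<Sum>K\<in>D. Sup K - Inf K) < \<delta>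
      \<longrightarrow> (\<Sum>K\<in>D. \<bar>c * f (Sup K) - c * f (Inf K)\<bar>) < \<epsilon>"
    by blast
qed

lemma abs_cont_on_add:
  assumes "abs_cont_on a b f" "abs_cont_on a b g"
  shows "abs_cont_on a b (\<lambda>t. f t + g t)"
  unfolding abs_cont_on_def
proof (intro allI impI)
  fix \<epsilon> :: real assume "\<epsilon> > 0"
  then have e: "\<epsilon> / 2 > 0" by simp
  obtain \<delta> where \<delta>: "\<delta> > 0" "\<And>D. D division_of \<Union>D \<Longrightarrow> \<Union>D \<subseteq> {a..b} \<Longrightarrow>
      (\<Sum>K\<in>D. Sup K - Inf K) < \<delta> \<Longrightarrow> (\<Sum>K\<in>D. \<bar>f (Sup K) - f (Inf K)\<bar>) < \<epsilon> / 2"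
    using assms(1) e unfolding abs_cont_on_def by meson
  obtain \<delta>' where \<delta>': "\<delta>' > 0" "\<And>D. D division_of \<Union>D \<Longrightarrow> \<Union>D \<subseteq> {a..b} \<Longrightarrow>
      (\<Sum>K\<in>D. Sup K - Inf K) < \<delta>' \<Longrightarrow> (\<Sum>K\<in>D. \<bar>g (Sup K) - g (Inf K)\<bar>) < \<epsilon> / 2"
    using assms(2) e unfolding abs_cont_on_def by meson
  have "(\<Sum>K\<in>D. \<bar>f (Sup K) + g (Sup K) - (f (Inf K) + g (Inf K))\<bar>) < \<epsilon>"
    if D: "D division_of \<Union>D" "\<Union>D \<subseteq> {a..b}" "(\<Sum>K\<in>D. Sup K - Inf K) < min \<delta> \<delta>'" for D
  proof -
    have "(\<Sum>K\<in>D. \<bar>f (Sup K) + g (Sup K) - (f (Inf K) + g (Inf K))\<bar>) \<le>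
        (\<Sum>K\<in>D. \<bar>f (Sup K) - f (Inf K)\<bar> + \<bar>g (Sup K) - g (Inf K)\<bar>)"
      by (intro sum_mono) linarith
    also have "\<dots> < \<epsilon> / 2 + \<epsilon> / 2"
      unfolding sum.distrib using D by (intro add_strict_mono \<delta> \<delta>') auto
    finally show ?thesis by simp
  qed
  moreover have "min \<delta> \<delta>' > 0" using \<delta>(1) \<delta>'(1) by simp
  ultimately show "\<exists>\<delta>>0. \<forall>D. D division_of \<Union>D \<and> \<Union>D \<subseteq> {a..b} \<and> (\<Sum>K\<in>D. Sup K - Inf K) < \<delta>
      \<longrightarrow> (\<Sum>K\<in>D. \<bar>f (Sup K) + g (Sup K) - (f (Inf K) + g (Inf K))\<bar>) < \<epsilon>"
    by blast
qed

lemma abs_cont_on_subset: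
  assumes "abs_cont_on a b f" "a \<le> a'" "b' \<le> b"
  shows "abs_cont_on a' b' f"
proof -
  have "{a'..b'} \<subseteq> {a..b}" using assms by auto
  then show ?thesis using assms(1) unfolding abs_cont_on_def by (meson order_trans)
qed

theorem abs_cont_on_fundamental_theorem:
  assumes ac: "abs_cont_on a b f" and ab: "a \<le> b" and N: "negligible N"
    and der: "\<And>x. x \<in> {a..b} - N \<Longrightarrow> (f has_real_derivative g x) (at x)"
  shows "(g has_integral (f b - f a)) {a..b}"
proof -
  define g' where "g' = (\<lambda>x. if x \<in> N then 0 else g x)"
  have "(g' has_integral (f b - f a)) {a..b}"
    unfolding has_integral_real
  proof (intro allI impI)
    fix \<epsilon> :: real assume \<epsilon>: "\<epsilon> > 0"
    define e where "e = \<epsilon> / (2 * (b - a + 1))"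
    have e: "e > 0" and eb: "e * (b - a) < \<epsilon> / 2"
      using \<epsilon> ab unfolding e_def by (auto simp: field_simps)
    have "\<epsilon> / 2 > 0" using \<epsilon> by simp
    then obtain \<delta> where \<delta>: "\<delta> > 0" "\<And>D. D division_of \<Union>D \<Longrightarrow> \<Union>D \<subseteq> {a..b} \<Longrightarrow>
        (\<Sum>K\<in>D. Sup K - Inf K) < \<delta> \<Longrightarrow> (\<Sum>K\<in>D. \<bar>f (Sup K) - f (Inf K)\<bar>) < \<epsilon> / 2"
      using ac unfolding abs_cont_on_def by meson
    have Nnull: "N \<in> null_sets lebesgue" using N negligible_iff_null_sets by blast
    then obtain U where U: "open U" "N \<subseteq> U" "U - N \<in> lmeasurable"
        "emeasure lebesgue (U - N) < ennreal \<delta>"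
      using sets_lebesgue_outer_open[OF _ \<delta>(1), of N] by auto
    have mU: "U \<in> lmeasurable" "measure lebesgue U < \<delta>"
    proof -
      have eq: "emeasure lebesgue U = emeasure lebesgue (U - N)"
        using Nnull U(1) by (simp add: emeasure_Diff_null_set)
      have "emeasure lebesgue U < ennreal \<delta>" using U(4) eq by simp
      then show "U \<in> lmeasurable"
        using U(1) by (intro fmeasurableI) (auto intro: order_less_trans)
      then have "ennreal (measure lebesgue U) < ennreal \<delta>"
        using \<open>emeasure lebesgue U < ennreal \<delta>\<close> by (simp add: emeasure_eq_measure2)
      then show "measure lebesgue U < \<delta>"
        using \<delta>(1) by (simp add: ennreal_less_iff)
    qed
    have "\<exists>d>0. (x \<in> N \<longrightarrow> ball x d \<subseteq> U) \<and> (x \<in> {a..b} - N \<longrightarrow>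
        (\<forall>y. \<bar>y - x\<bar> < d \<longrightarrow> \<bar>f y - f x - (y - x) * g x\<bar> \<le> e * \<bar>y - x\<bar>))" for x
    proof (cases "x \<in> N")
      case True
      then show ?thesis using U(1,2) by (meson DiffD2 openE subsetD)
    next
      case False
      show ?thesis
      proof (cases "x \<in> {a..b}")
        case True
        then have "(f has_derivative (\<lambda>h. h * g x)) (at x)"
          using der[of x] False unfolding has_field_derivative_def
          by (simp add: mult.commute[of _ "g x"])
        then show ?thesis
          using e False unfolding has_derivative_at_alt by auto
      qed (use False zero_less_one in blast)
    qed
    then obtain d where d: "\<And>x. d x > 0" "\<And>x. x \<in> N \<Longrightarrow> ball x (d x) \<subseteq> U"
        "\<And>x y. x \<in> {a..b} - N \<Longrightarrow> \<bar>y - x\<bar> < d x \<Longrightarrow>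
          \<bar>f y - f x - (y - x) * g x\<bar> \<le> e * \<bar>y - x\<bar>"
      by metis
    show "\<exists>\<gamma>. gauge \<gamma> \<and> (\<forall>p. p tagged_division_of {a..b} \<and> \<gamma> fine p \<longrightarrow>
        norm ((\<Sum>(x, K)\<in>p. Henstock_Kurzweil_Integration.content K *\<^sub>R g' x) - (f b - f a)) < \<epsilon>)"
    proof (intro exI conjI allI impI)
      show "gauge (\<lambda>x. ball x (d x))" using d(1) gauge_ball_dependent by blast
      fix p assume "p tagged_division_of {a..b} \<and> (\<lambda>x. ball x (d x)) fine p"
      then have p: "p tagged_division_of {a..b}" and fine: "(\<lambda>x. ball x (d x)) fine p" by auto
      have finp: "finite p" using p by blast
      have sums: "(\<Sum>(x,K)\<in>p. Sup K - Inf K) = b - a"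
          "(\<Sum>(x,K)\<in>p. f (Sup K) - f (Inf K)) = f b - f a"
        using additive_tagged_division_1[OF ab p] by auto
      define q where "q = {z \<in> p. fst z \<in> N}"
      have intv: "\<exists>u v. K = {u..v} \<and> u \<le> v \<and> u \<in> K \<and> v \<in> K \<and> x \<in> K \<and>
          Sup K = v \<and> Inf K = u \<and> K \<subseteq> {a..b} \<and> K \<subseteq> ball x (d x)"
        if xKp: "(x, K) \<in> p" for x K
      proof -
        have xK: "x \<in> K" using tagged_division_ofD(2)[OF p xKp] .
        obtain u v where "K = cbox u v" using tagged_division_ofD(4)[OF p xKp] by blast
        moreover note xK
        moreover have "K \<subseteq> {a..b}" using tagged_division_ofD(3)[OF p xKp] .
        moreover have "K \<subseteq> ball x (d x)" using fine that unfolding fine_def by auto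
        ultimately show ?thesis by (intro exI[of _ u] exI[of _ v]) auto
      qed
      let ?w = "\<lambda>(x, K). if x \<in> N then \<bar>f (Sup K) - f (Inf K)\<bar> else 0"
      have "norm ((\<Sum>(x, K)\<in>p. Henstock_Kurzweil_Integration.content K *\<^sub>R g' x) - (f b - f a)) =
          norm (\<Sum>(x, K)\<in>p. Henstock_Kurzweil_Integration.content K * g' x - (f (Sup K) - f (Inf K)))"
        unfolding sums(2)[symmetric] by (simp add: split_def sum_subtractf)
      also have "\<dots> \<le> (\<Sum>z\<in>p. e * (case z of (x, K) \<Rightarrow> Sup K - Inf K) + ?w z)"
      proof (rule sum_norm_le)
        fix z assume "z \<in> p"
        moreover obtain x K where z: "z = (x, K)" by (cases z)
        ultimately have "(x, K) \<in> p" by simp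
        then obtain u v where K: "K = {u..v}" "u \<le> v" "u \<in> K" "v \<in> K" "x \<in> K"
            "Sup K = v" "Inf K = u" "K \<subseteq> {a..b}" "K \<subseteq> ball x (d x)"
          using intv by blast
        have "\<bar>Henstock_Kurzweil_Integration.content K * g' x - (f (Sup K) - f (Inf K))\<bar>
            \<le> e * (Sup K - Inf K) + ?w (x, K)"
        proof (cases "x \<in> N")
          case True
          moreover have "0 \<le> e * (v - u)" using K(2) e by simp
          ultimately show ?thesis using K(6,7) by (simp add: g'_def abs_minus_commute)
        next
          case False
          have x: "x \<in> {a..b} - N" "u \<le> x" "x \<le> v" using False K by auto
          have "\<bar>u - x\<bar> < d x" "\<bar>v - x\<bar> < d x"
            using K(3,4,9) by (auto simp: dist_real_def)
          then have "\<bar>f u - f x - (u - x) * g x\<bar> \<le> e * \<bar>u - x\<bar>"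
              "\<bar>f v - f x - (v - x) * g x\<bar> \<le> e * \<bar>v - x\<bar>"
            using d(3)[OF x(1)] by auto
          then have "\<bar>f u - f x - (u - x) * g x\<bar> \<le> e * (x - u)"
              "\<bar>f v - f x - (v - x) * g x\<bar> \<le> e * (v - x)"
            using x by auto
          then have "\<bar>(v - u) * g x - (f v - f u)\<bar> \<le> e * (v - u)"
            by (simp add: algebra_simps abs_le_iff)
          then show ?thesis using False K by (simp add: g'_def)
        qed
        then show "norm (case z of (x, K) \<Rightarrow>
            Henstock_Kurzweil_Integration.content K * g' x - (f (Sup K) - f (Inf K)))
            \<le> e * (case z of (x, K) \<Rightarrow> Sup K - Inf K) + ?w z"
          unfolding z by simp
      qed
      also have "\<dots> = e * (b - a) + (\<Sum>z\<in>p. ?w z)"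
        unfolding sum.distrib sum_distrib_left[symmetric] sums(1) ..
      finally have le: "norm ((\<Sum>(x, K)\<in>p. Henstock_Kurzweil_Integration.content K *\<^sub>R g' x) - (f b - f a))
          \<le> e * (b - a) + (\<Sum>z\<in>p. ?w z)" .
      have "(\<Sum>z\<in>p. ?w z) = (\<Sum>(x, K)\<in>q. \<bar>f (Sup K) - f (Inf K)\<bar>)"
      proof -
        have "(\<Sum>(x, K)\<in>q. \<bar>f (Sup K) - f (Inf K)\<bar>) =
            (\<Sum>z\<in>p. if fst z \<in> N then (case z of (x, K) \<Rightarrow> \<bar>f (Sup K) - f (Inf K)\<bar>) else 0)"
          unfolding q_def by (rule sum.inter_filter[OF finp])
        also have "\<dots> = (\<Sum>z\<in>p. ?w z)"
        proof (rule sum.cong)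
          fix z show "(if fst z \<in> N then (case z of (x, K) \<Rightarrow> \<bar>f (Sup K) - f (Inf K)\<bar>) else 0) = ?w z"
            by (cases z) (simp only: fst_conv prod.case)
        qed (rule refl)
        finally show ?thesis by (rule sym)
      qed
      moreover have "(\<Sum>(x, K)\<in>q. \<bar>f (Sup K) - f (Inf K)\<bar>) < \<epsilon> / 2"
      proof -
        have "q tagged_partial_division_of {a..b}"
          by (rule tagged_partial_division_subset[of p]) (use p in \<open>auto simp: tagged_division_of_def q_def\<close>)
        then have q: "q tagged_division_of \<Union>(snd ` q)"
          by (rule tagged_partial_division_of_Union_self)
        then have D: "snd ` q division_of \<Union>(snd ` q)"
          by (rule division_of_tagged_division)
        have sub: "\<Union>(snd ` q) \<subseteq> {a..b}" "\<Union>(snd ` q) \<subseteq> U"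
        proof -
          have "K \<subseteq> {a..b} \<and> K \<subseteq> U" if "(x, K) \<in> q" for x K
            using that intv[of x K] d(2)[of x] unfolding q_def by auto
          then show "\<Union>(snd ` q) \<subseteq> {a..b}" "\<Union>(snd ` q) \<subseteq> U" by fastforce+
        qed
        have "(\<Sum>K\<in>snd ` q. Sup K - Inf K) = (\<Sum>K\<in>snd ` q. measure lebesgue K)"
        proof (rule sum.cong)
          fix K assume "K \<in> snd ` q"
          then obtain x where "(x, K) \<in> p" unfolding q_def by auto
          then obtain u v where "K = {u..v}" "u \<le> v" "Sup K = v" "Inf K = u"
            using intv by blast
          then show "Sup K - Inf K = measure lebesgue K" by simp
        qed simp
        also have "\<dots> = measure lebesgue (\<Union>(snd ` q))"
          by (rule content_division[OF D])
        also have "\<dots> \<le> measure lebesgue U"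
          using sub mU(1) lmeasurable_division[OF D] by (intro measure_mono_fmeasurable) auto
        also have "\<dots> < \<delta>" by (rule mU)
        finally have "(\<Sum>K\<in>snd ` q. \<bar>f (Sup K) - f (Inf K)\<bar>) < \<epsilon> / 2"
          using \<delta>(2)[OF D sub(1)] by simp
        moreover have "(\<Sum>(x, K)\<in>q. \<bar>f (Sup K) - f (Inf K)\<bar>) = (\<Sum>K\<in>snd ` q. \<bar>f (Sup K) - f (Inf K)\<bar>)"
        proof -
          let ?d = "\<lambda>K. if K = {} then 0 else \<bar>f (Sup K) - f (Inf K)\<bar>"
          have ne: "K \<noteq> {}" if "(x, K) \<in> q" for x K
            using tagged_division_ofD(2)[OF q that] by blast
          have "(\<Sum>(x, K)\<in>q. \<bar>f (Sup K) - f (Inf K)\<bar>) = (\<Sum>(x, K)\<in>q. ?d K)"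
            using ne by (intro sum.cong) auto
          also have "\<dots> = (\<Sum>K\<in>snd ` q. ?d K)"
          proof (rule sum.over_tagged_division_lemma[OF q])
            fix u v :: real assume "box u v = {}"
            then show "?d (cbox u v) = 0" by (cases "u = v") auto
          qed
          also have "\<dots> = (\<Sum>K\<in>snd ` q. \<bar>f (Sup K) - f (Inf K)\<bar>)"
            using ne by (intro sum.cong) auto
          finally show ?thesis .
        qed
        ultimately show ?thesis by simp
      qed
      ultimately show "norm ((\<Sum>(x, K)\<in>p. Henstock_Kurzweil_Integration.content K *\<^sub>R g' x) - (f b - f a)) < \<epsilon>"
        using le eb by linarith
    qed
  qed
  then show ?thesis
    by (rule has_integral_spike[OF N, rotated]) (simp add: g'_def)
qed

lemma complete_measure_lebesgue_on:
  assumes "S \<in> sets lebesgue"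
  shows "complete_measure (lebesgue_on S)"
proof
  fix A B assume "B \<subseteq> A" "A \<in> null_sets (lebesgue_on S)"
  with assms show "B \<in> sets (lebesgue_on S)"
    using null_sets_completion_subset[of B A lborel]
    by (auto simp: null_sets_restrict_space sets_restrict_space_iff)
qed

lemma borel_measurable_lebesgue_on_cong_AE:
  fixes f g :: "'a::euclidean_space \<Rightarrow> 'b::topological_space"
  assumes S: "S \<in> sets lebesgue" and f: "f \<in> borel_measurable (lebesgue_on S)"
    and eq: "AE x in lebesgue_on S. f x = g x"
  shows "g \<in> borel_measurable (lebesgue_on S)"
proof (rule measurableI)
  interpret complete_measure "lebesgue_on S" by (rule complete_measure_lebesgue_on[OF S])
  fix A :: "'b set" assume A: "A \<in> sets borel"
  show "g -` A \<inter> space (lebesgue_on S) \<in> sets (lebesgue_on S)"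
  proof (rule in_sets_AE)
    show "f -` A \<inter> space (lebesgue_on S) \<in> sets (lebesgue_on S)"
      using f A by (rule measurable_sets)
    show "AE x in lebesgue_on S.
        (x \<in> f -` A \<inter> space (lebesgue_on S)) = (x \<in> g -` A \<inter> space (lebesgue_on S))"
      using eq by eventually_elim auto
  qed auto
qed auto

lemma square_integrable_lebesgue_on_cong_AE:
  assumes S: "S \<in> sets lebesgue" and f: "square_integrable (lebesgue_on S) f"
    and eq: "AE x in lebesgue_on S. f x = g x"
  shows "square_integrable (lebesgue_on S) g"
proof -
  have g: "g \<in> borel_measurable (lebesgue_on S)"
    using borel_measurable_lebesgue_on_cong_AE[OF S _ eq] f unfolding square_integrable_def by blast
  have "integrable (lebesgue_on S) (\<lambda>x. (g x)\<^sup>2) \<longleftrightarrow> integrable (lebesgue_on S) (\<lambda>x. (f x)\<^sup>2)"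
    using f g eq unfolding square_integrable_def by (intro integrable_cong_AE) auto
  with f g show ?thesis unfolding square_integrable_def by simp
qed

text \<open>
  The a.e. differentiability clause is a consequence of absolute continuity (Lebesgue's theorem);
  it is kept so that the linear structure below does not depend on that theorem. At the exceptional
  points, \<open>deriv h\<close> has an unspecified value.
\<close>

typedef cameron_martin =
  "{h :: real \<Rightarrow> real. abs_cont_on 0 1 h \<and> h 0 = 0 \<and> (\<forall>t. t \<notin> {0..1} \<longrightarrow> h t = 0) \<and>
     (AE t in lebesgue_on {0..1}. h differentiable (at t)) \<and>
     square_integrable (lebesgue_on {0..1}) (deriv h)}"
  morphisms cm_fun Abs_cm
  by (rule exI[of _ "\<lambda>_. 0"]) (simp add: abs_cont_on_0 square_integrable_def)

setup_lifting type_definition_cameron_martin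

definition cm_deriv :: "cameron_martin \<Rightarrow> real \<Rightarrow> real"
  where "cm_deriv h = deriv (cm_fun h)"

lemma abs_cont_on_cm_fun: "abs_cont_on 0 1 (cm_fun h)"
  and cm_fun_0: "cm_fun h 0 = 0"
  and cm_fun_outside: "t \<notin> {0..1} \<Longrightarrow> cm_fun h t = 0"
  and square_integrable_cm_deriv: "square_integrable (lebesgue_on {0..1}) (cm_deriv h)"
  using cm_fun[of h] by (auto simp: cm_deriv_def)

lemma AE_has_derivative_cm_deriv:
  "AE t in lebesgue_on {0..1}. (cm_fun h has_real_derivative cm_deriv h t) (at t)"
proof -
  have "AE t in lebesgue_on {0..1}. cm_fun h differentiable (at t)"
    using cm_fun[of h] by simp
  then show ?thesis
    by eventually_elim (simp add: cm_deriv_def DERIV_deriv_iff_real_differentiable)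
qed

lemma has_integral_cm_deriv:
  assumes "0 \<le> a" "a \<le> b" "b \<le> 1"
  shows "(cm_deriv h has_integral (cm_fun h b - cm_fun h a)) {a..b}"
proof -
  let ?N = "{t \<in> {0..1}. \<not> (cm_fun h has_real_derivative cm_deriv h t) (at t)}"
  have "?N \<in> null_sets (lebesgue_on {0..1})"
    using AE_has_derivative_cm_deriv[of h]
    by (simp add: complete_measure.AE_iff_null_sets complete_measure_lebesgue_on)
  then have "negligible ?N"
    by (simp add: null_sets_restrict_space negligible_iff_null_sets)
  moreover have "abs_cont_on a b (cm_fun h)"
    using abs_cont_on_cm_fun assms(1,3) by (rule abs_cont_on_subset)
  ultimately show ?thesis
    using assms by (intro abs_cont_on_fundamental_theorem[of a b _ ?N]) auto
qed

lemma cm_space_add: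
  fixes f g :: "real \<Rightarrow> real"
  assumes f: "AE t in lebesgue_on {0..1}. f differentiable (at t)"
      "square_integrable (lebesgue_on {0..1}) (deriv f)"
    and g: "AE t in lebesgue_on {0..1}. g differentiable (at t)"
      "square_integrable (lebesgue_on {0..1}) (deriv g)"
  shows "AE t in lebesgue_on {0..1}. (\<lambda>s. f s + g s) differentiable (at t)"
    and "AE t in lebesgue_on {0..1}. deriv f t + deriv g t = deriv (\<lambda>s. f s + g s) t"
    and "square_integrable (lebesgue_on {0..1}) (deriv (\<lambda>s. f s + g s))"
proof -
  show "AE t in lebesgue_on {0..1}. (\<lambda>s. f s + g s) differentiable (at t)"
    using f(1) g(1) by eventually_elim (rule differentiable_add)
  show *: "AE t in lebesgue_on {0..1}. deriv f t + deriv g t = deriv (\<lambda>s. f s + g s) t"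
    using f(1) g(1)
    by eventually_elim
      (rule sym, rule DERIV_imp_deriv, rule DERIV_add, simp_all add: DERIV_deriv_iff_real_differentiable)
  show "square_integrable (lebesgue_on {0..1}) (deriv (\<lambda>s. f s + g s))"
    by (rule square_integrable_lebesgue_on_cong_AE[OF _ square_integrable_add[OF f(2) g(2)] *]) simp
qed

lemma cm_space_scale:
  fixes f :: "real \<Rightarrow> real"
  assumes f: "AE t in lebesgue_on {0..1}. f differentiable (at t)"
      "square_integrable (lebesgue_on {0..1}) (deriv f)"
  shows "AE t in lebesgue_on {0..1}. (\<lambda>s. c * f s) differentiable (at t)"
    and "AE t in lebesgue_on {0..1}. c * deriv f t = deriv (\<lambda>s. c * f s) t"
    and "square_integrable (lebesgue_on {0..1}) (deriv (\<lambda>s. c * f s))"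
proof -
  show "AE t in lebesgue_on {0..1}. (\<lambda>s. c * f s) differentiable (at t)"
    using f(1) by eventually_elim (intro differentiable_mult differentiable_const)
  show *: "AE t in lebesgue_on {0..1}. c * deriv f t = deriv (\<lambda>s. c * f s) t"
    using f(1)
    by eventually_elim
      (rule sym, rule DERIV_imp_deriv, rule DERIV_cmult, simp add: DERIV_deriv_iff_real_differentiable)
  show "square_integrable (lebesgue_on {0..1}) (deriv (\<lambda>s. c * f s))"
    by (rule square_integrable_lebesgue_on_cong_AE[OF _ square_integrable_scale[OF f(2)] *]) simp
qed

instantiation cameron_martin :: real_inner
begin

lift_definition zero_cameron_martin :: cameron_martin is "\<lambda>_. 0"
  by (simp add: abs_cont_on_0 square_integrable_def)

lift_definition plus_cameron_martin :: "cameron_martin \<Rightarrow> cameron_martin \<Rightarrow> cameron_martin"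
  is "\<lambda>f g t. f t + g t"
  by (simp add: abs_cont_on_add cm_space_add)

lift_definition scaleR_cameron_martin :: "real \<Rightarrow> cameron_martin \<Rightarrow> cameron_martin"
  is "\<lambda>c f t. c * f t"
  by (simp add: abs_cont_on_scale cm_space_scale)

definition uminus_cameron_martin :: "cameron_martin \<Rightarrow> cameron_martin"
  where "uminus_cameron_martin h = (-1) *\<^sub>R h"

definition minus_cameron_martin :: "cameron_martin \<Rightarrow> cameron_martin \<Rightarrow> cameron_martin"
  where "minus_cameron_martin h k = h + (-1) *\<^sub>R k"

definition inner_cameron_martin :: "cameron_martin \<Rightarrow> cameron_martin \<Rightarrow> real"
  where "inner_cameron_martin h k = (\<integral>t. cm_deriv h t * cm_deriv k t \<partial>lebesgue_on {0..1})"

definition norm_cameron_martin :: "cameron_martin \<Rightarrow> real"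
  where "norm_cameron_martin h = sqrt (inner h h)"

definition dist_cameron_martin :: "cameron_martin \<Rightarrow> cameron_martin \<Rightarrow> real"
  where "dist_cameron_martin h k = norm (h - k)"

definition sgn_cameron_martin :: "cameron_martin \<Rightarrow> cameron_martin"
  where "sgn_cameron_martin h = inverse (norm h) *\<^sub>R h"

definition uniformity_cameron_martin :: "(cameron_martin \<times> cameron_martin) filter"
  where "uniformity_cameron_martin = (INF e\<in>{0<..}. principal {(h, k). dist h k < e})"

definition open_cameron_martin :: "cameron_martin set \<Rightarrow> bool"
  where "open_cameron_martin U =
    (\<forall>h\<in>U. eventually (\<lambda>(h', k). h' = h \<longrightarrow> k \<in> U) uniformity)"

instance
proof
  fix a b :: real and x y z :: cameron_martin
  show "x + y + z = x + (y + z)" by transfer (simp add: algebra_simps)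
  show "x + y = y + x" by transfer (simp add: algebra_simps)
  show "0 + x = x" by transfer simp
  show "- x + x = 0" unfolding uminus_cameron_martin_def by transfer simp
  show "x - y = x + - y" unfolding uminus_cameron_martin_def minus_cameron_martin_def ..
  show "a *\<^sub>R (x + y) = a *\<^sub>R x + a *\<^sub>R y" by transfer (simp add: algebra_simps)
  show "(a + b) *\<^sub>R x = a *\<^sub>R x + b *\<^sub>R x" by transfer (simp add: algebra_simps)
  show "a *\<^sub>R b *\<^sub>R x = (a * b) *\<^sub>R x" by transfer (simp add: algebra_simps)
  show "1 *\<^sub>R x = x" by transfer simp
  show "dist x y = norm (x - y)" by (rule dist_cameron_martin_def)
  show "sgn x = inverse (norm x) *\<^sub>R x" by (rule sgn_cameron_martin_def)
  show "uniformity = (INF e\<in>{0<..}. principal {(x :: cameron_martin, y). dist x y < e})"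
    by (rule uniformity_cameron_martin_def)
  show "norm x = sqrt (inner x x)" by (rule norm_cameron_martin_def)
  fix U :: "cameron_martin set"
  show "open U = (\<forall>x\<in>U. eventually (\<lambda>(x', y). x' = x \<longrightarrow> y \<in> U) uniformity)"
    by (rule open_cameron_martin_def)
next
  fix r :: real and x y z :: cameron_martin
  let ?I = "lebesgue_on {0..1::real}"
  note [measurable] = square_integrable_cm_deriv[unfolded square_integrable_def, THEN conjunct1]
  note int = square_integrable_mult[OF square_integrable_cm_deriv square_integrable_cm_deriv]
  show "inner x y = inner y x"
    unfolding inner_cameron_martin_def by (simp add: mult.commute)
  have "AE t in ?I. cm_deriv x t + cm_deriv y t = cm_deriv (x + y) t"
    unfolding cm_deriv_def by transfer (simp add: cm_space_add(2))
  then have "AE t in ?I. cm_deriv (x + y) t * cm_deriv z t =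
      cm_deriv x t * cm_deriv z t + cm_deriv y t * cm_deriv z t"
    by eventually_elim (metis distrib_right)
  then have "inner (x + y) z = (\<integral>t. cm_deriv x t * cm_deriv z t + cm_deriv y t * cm_deriv z t \<partial>?I)"
    unfolding inner_cameron_martin_def
    by (intro integral_cong_AE) measurable
  then show "inner (x + y) z = inner x z + inner y z"
    unfolding inner_cameron_martin_def by (simp add: int)
  have "AE t in ?I. r * cm_deriv x t = cm_deriv (r *\<^sub>R x) t"
    unfolding cm_deriv_def by transfer (simp add: cm_space_scale(2))
  then have "AE t in ?I. cm_deriv (r *\<^sub>R x) t * cm_deriv y t = r * (cm_deriv x t * cm_deriv y t)"
    by eventually_elim (metis mult.assoc)
  then have "inner (r *\<^sub>R x) y = (\<integral>t. r * (cm_deriv x t * cm_deriv y t) \<partial>?I)"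
    unfolding inner_cameron_martin_def
    by (intro integral_cong_AE) measurable
  then show "inner (r *\<^sub>R x) y = r * inner x y"
    unfolding inner_cameron_martin_def by simp
  show "0 \<le> inner x x"
    unfolding inner_cameron_martin_def by simp
  show "(inner x x = 0) = (x = 0)"
  proof
    assume "inner x x = 0"
    then have AE: "AE t in ?I. cm_deriv x t = 0"
      unfolding inner_cameron_martin_def
      by (subst (asm) integral_nonneg_eq_0_iff_AE) (auto intro: int)
    let ?N = "{t \<in> {0..1}. cm_deriv x t \<noteq> 0}"
    have "?N \<in> null_sets ?I"
      using AE by (simp add: complete_measure.AE_iff_null_sets complete_measure_lebesgue_on)
    then have N: "negligible ?N"
      by (simp add: null_sets_restrict_space negligible_iff_null_sets)
    have "cm_fun x t = 0" for t
    proof (cases "t \<in> {0..1}")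
      case True
      then have "(cm_deriv x has_integral (cm_fun x t - cm_fun x 0)) {0..t}"
        by (intro has_integral_cm_deriv) auto
      moreover have "(cm_deriv x has_integral 0) {0..t}"
        using True by (intro has_integral_negligible[OF N]) auto
      ultimately have "cm_fun x t - cm_fun x 0 = 0"
        by (rule has_integral_unique)
      then show ?thesis using cm_fun_0[of x] by simp
    qed (rule cm_fun_outside)
    then show "x = 0" by transfer auto
  next
    assume "x = 0"
    moreover have "cm_deriv 0 t = 0" for t
      unfolding cm_deriv_def by transfer simp
    ultimately show "inner x x = 0" unfolding inner_cameron_martin_def by simp
  qed
qed

end


section \<open>Wiener measure and the Wiener integral\<close>

definition wiener_measure :: "wiener_space measure \<Rightarrow> bool"
  where "wiener_measure \<mu> \<longleftrightarrow> prob_space \<mu> \<and> sets \<mu> = sets borel \<and>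
    (\<forall>s t. 0 \<le> s \<and> s < t \<and> t \<le> 1 \<longrightarrow>
      distributed \<mu> lborel (\<lambda>\<omega>. path_fun \<omega> t - path_fun \<omega> s) (normal_density 0 (sqrt (t - s)))) \<and>
    (\<forall>n (t :: nat \<Rightarrow> real). 0 \<le> t 0 \<and> (\<forall>i<n. t i < t (Suc i)) \<and> t n \<le> 1 \<longrightarrow>
      prob_space.indep_vars \<mu> (\<lambda>_. borel)
        (\<lambda>i \<omega>. path_fun \<omega> (t (Suc i)) - path_fun \<omega> (t i)) {..<n})"

text \<open>
  A list of triples \<open>(a, u, v)\<close> encodes the step function \<open>\<Sum> a * 1\<^bsub>(u,v]\<^esub>\<close>.
\<close>

definition step_fun :: "(real \<times> real \<times> real) list \<Rightarrow> real \<Rightarrow> real"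
  where "step_fun p t = (\<Sum>(a, u, v)\<leftarrow>p. a * indicator {u<..v} t)"

definition step_integral :: "(real \<times> real \<times> real) list \<Rightarrow> wiener_space \<Rightarrow> real"
  where "step_integral p \<omega> = (\<Sum>(a, u, v)\<leftarrow>p. a * (path_fun \<omega> v - path_fun \<omega> u))"

text \<open>
  \<open>is_wiener_integral \<mu> h X\<close>: the random variable \<open>X\<close> is a version of
  \<open>I(h) \<in> L\<^sup>2(\<mu>)\<close>, the \<open>L\<^sup>2\<close> limit of the integrals of step functions approximating the
  derivative of \<open>h\<close>.
\<close>

definition is_wiener_integral ::
    "wiener_space measure \<Rightarrow> cameron_martin \<Rightarrow> (wiener_space \<Rightarrow> real) \<Rightarrow> bool"
  where "is_wiener_integral \<mu> h X \<longleftrightarrow> square_integrable \<mu> X \<and>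
    (\<exists>p. (\<forall>n. \<forall>(a, u, v)\<in>set (p n). 0 \<le> u \<and> u \<le> v \<and> v \<le> 1) \<and>
      (\<lambda>n. \<integral>t. (step_fun (p n) t - cm_deriv h t)\<^sup>2 \<partial>lebesgue_on {0..1}) \<longlonglongrightarrow> 0 \<and>
      (\<lambda>n. \<integral>\<omega>. (step_integral (p n) \<omega> - X \<omega>)\<^sup>2 \<partial>\<mu>) \<longlonglongrightarrow> 0)"

text \<open>
  \<open>is_dual_version \<mu> h \<phi>\<close>: \<open>h\<close> lies in \<open>H\<^bsub>C\<^sub>0*\<^esub>\<close> and \<open>\<phi>\<close> is the continuous linear
  functional denoted \<open>I(h)\<close>. (It is unique, since \<open>\<mu>\<close> has full support.)
\<close>

definition is_dual_version ::
    "wiener_space measure \<Rightarrow> cameron_martin \<Rightarrow> (wiener_space \<Rightarrow> real) \<Rightarrow> bool"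
  where "is_dual_version \<mu> h \<phi> \<longleftrightarrow> bounded_linear \<phi> \<and> is_wiener_integral \<mu> h \<phi>"


section \<open>The conditioned measure and the Gaussian Radon transform\<close>

definition nearest_to_0 :: "'a::real_inner set \<Rightarrow> 'a"
  where "nearest_to_0 L = (THE x. x \<in> L \<and> (\<forall>y\<in>L. norm x \<le> norm y))"

definition direction :: "'a::real_inner set \<Rightarrow> 'a set"
  where "direction L = (\<lambda>x. x - nearest_to_0 L) ` L"

definition orth_proj :: "'a::real_inner set \<Rightarrow> 'a \<Rightarrow> 'a"
  where "orth_proj V x = (THE p. p \<in> V \<and> (\<forall>q\<in>V. inner (x - p) q = 0))"

definition conditioned_measure ::
    "wiener_space measure \<Rightarrow> cameron_martin set \<Rightarrow> wiener_space measure \<Rightarrow> bool"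
  where "conditioned_measure \<mu> L \<nu> \<longleftrightarrow> prob_space \<nu> \<and> sets \<nu> = sets borel \<and>
    (\<forall>h \<phi>. is_dual_version \<mu> h \<phi> \<longrightarrow>
      (\<integral>\<omega>. exp (\<i> * complex_of_real (\<phi> \<omega>)) \<partial>\<nu>) =
      exp (\<i> * complex_of_real (inner (nearest_to_0 L) h) -
        complex_of_real ((norm (orth_proj (direction L) h))\<^sup>2 / 2)))"

text \<open>
  \<open>extended_wiener_integral \<mu> \<nu> J\<close>: choosing representatives, \<open>J\<close> is the continuous linear
  extension \<open>I\<^sub>L : H\<^sub>0 \<rightarrow> L\<^sup>2(\<nu>)\<close> of \<open>h \<mapsto> I(h)\<close>, where \<open>\<nu> = \<mu>\<^sub>L\<close>.
\<close>

definition extended_wiener_integral ::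
    "wiener_space measure \<Rightarrow> wiener_space measure \<Rightarrow> (cameron_martin \<Rightarrow> wiener_space \<Rightarrow> real) \<Rightarrow> bool"
  where "extended_wiener_integral \<mu> \<nu> J \<longleftrightarrow>
    (\<forall>h. square_integrable \<nu> (J h)) \<and>
    (\<forall>h k. AE \<omega> in \<nu>. J (h + k) \<omega> = J h \<omega> + J k \<omega>) \<and>
    (\<forall>c h. AE \<omega> in \<nu>. J (c *\<^sub>R h) \<omega> = c * J h \<omega>) \<and>
    (\<forall>h k. k \<longlonglongrightarrow> h \<longrightarrow> (\<lambda>n. \<integral>\<omega>. (J (k n) \<omega> - J h \<omega>)\<^sup>2 \<partial>\<nu>) \<longlonglongrightarrow> 0) \<and>
    (\<forall>h \<phi>. is_dual_version \<mu> h \<phi> \<longrightarrow> (AE \<omega> in \<nu>. J h \<omega> = \<phi> \<omega>))"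

text \<open>\<open>G\<phi>\<close> at \<open>L\<close> as a function of \<open>\<nu> = \<mu>\<^sub>L\<close>; meaningful only for \<open>\<nu>\<close>-integrable \<open>\<phi>\<close>.\<close>

definition gaussian_radon_transform ::
    "wiener_space measure \<Rightarrow> (wiener_space \<Rightarrow> real) \<Rightarrow> real"
  where "gaussian_radon_transform \<nu> \<phi> = (\<integral>\<omega>. \<phi> \<omega> \<partial>\<nu>)"

definition pinned :: "nat \<Rightarrow> (nat \<Rightarrow> real) \<Rightarrow> (nat \<Rightarrow> real) \<Rightarrow> cameron_martin set"
  where "pinned m T c = {h. \<forall>k\<in>{1..m}. cm_fun h (T k) = c k}"

end

(*
  The kernel e_t(s) = min s t satisfies <e_t, h> = h(t), so L_T(c) is cut out by finitely many
  inner products, its nearest point to 0 is the piecewise linear interpolant h_L of the data, and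
  <h_L, h> is the right-hand side of the formula. Evaluation at t is the dual version of e_t; its
  characteristic function under the conditioned measure is Gaussian, and differentiating at 0 gives
  the mean h_L(t) = <h_L, e_t>. Both h |-> E(J h) and h |-> <h_L, h> are linear and continuous, and
  the span of the e_t is dense because step functions are dense in L^2[0,1].
*)

theory Submission
  imports Defs
begin

section \<open>Step functions are dense in \<open>L\<^sup>2[0,1]\<close>\<close>

text \<open>The measure \<open>\<nu>\<close> is specified only through its characteristic functional
  on dual elements, so every mean has to be extracted from there. One dual element is not enough for
  that: the whole line \<open>s *\<^sub>R kernel t\<close> is used, and the exponent must be
  quadratic in \<open>s\<close>. This is why the projection onto the direction space is computed
  explicitly and shown to be homogeneous. The finite second moment that justifies differentiating at
  0 is borrowed from \<open>J\<close>, which agrees with the evaluation \<open>\<nu>\<close>-almost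
  everywhere. Evaluations are the natural test family because the derivative of
  \<open>kernel t\<close> is an indicator, so that their Wiener integrals are step integrals with no
  limit to take. Since \<open>nearest_to_0\<close> and \<open>orth_proj\<close> are definite
  descriptions, explicit candidates are certified by orthogonality, which settles existence and
  uniqueness together.\<close>

definition valid_steps :: "(real \<times> real \<times> real) list \<Rightarrow> bool"
  where "valid_steps p \<longleftrightarrow> (\<forall>(a, u, v)\<in>set p. 0 \<le> u \<and> u \<le> v \<and> v \<le> 1)"

lemma valid_steps_simps [simp]:
  "valid_steps []"
  "valid_steps ((a, u, v) # p) \<longleftrightarrow> 0 \<le> u \<and> u \<le> v \<and> v \<le> 1 \<and> valid_steps p"
  "valid_steps (p @ q) \<longleftrightarrow> valid_steps p \<and> valid_steps q"
  by (auto simp: valid_steps_def ball_Un)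

lemma step_fun_simps [simp]:
  "step_fun [] t = 0"
  "step_fun ((a, u, v) # p) t = a * indicator {u<..v} t + step_fun p t"
  "step_fun (p @ q) t = step_fun p t + step_fun q t"
  by (auto simp: step_fun_def)

lemma step_fun_scale: "step_fun (map (apfst ((*) c)) p) t = c * step_fun p t"
  by (induction p) (auto simp: algebra_simps)

lemma valid_steps_scale: "valid_steps (map (apfst ((*) c)) p) \<longleftrightarrow> valid_steps p"
  by (induction p) auto

abbreviation unit_interval_measure :: "real measure" (\<open>\<U>\<close>)
  where "\<U> \<equiv> lebesgue_on {0..1}"

lemma finite_measure_unit_interval: "finite_measure \<U>"
  by (intro finite_measureI) (simp add: emeasure_restrict_space)

lemma square_integrable_unit_bounded:
  assumes "f \<in> borel_measurable \<U>" "\<And>t. \<bar>f t\<bar> \<le> B"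
  shows "square_integrable \<U> f"
  unfolding square_integrable_def
proof (intro conjI finite_measure.integrable_const_bound[OF finite_measure_unit_interval, of _ "B\<^sup>2"])
  show "AE t in \<U>. norm ((f t)\<^sup>2) \<le> B\<^sup>2"
    using assms(2) by (auto simp: abs_le_square_iff[symmetric] intro!: AE_I2 order_trans[OF _ abs_ge_self])
qed (use assms(1) in auto)

lemma borel_measurable_unitI: "f \<in> borel_measurable borel \<Longrightarrow> f \<in> borel_measurable \<U>"
  by (intro measurable_restrict_space1 measurable_completion) simp

lemma square_integrable_indicator:
  assumes "A \<in> sets borel"
  shows "square_integrable \<U> (indicator A)"
  by (rule square_integrable_unit_bounded[where B = 1])
     (use assms in \<open>auto intro!: borel_measurable_unitI split: split_indicator\<close>)

lemma square_integrable_step_fun: "square_integrable \<U> (step_fun p)"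
proof (induction p)
  case Nil
  show ?case by (simp add: square_integrable_def)
next
  case (Cons x p)
  obtain a u v where x: "x = (a, u, v)" by (cases x)
  have "square_integrable \<U> (\<lambda>t. a * indicator {u<..v} t + step_fun p t)"
    by (intro square_integrable_add square_integrable_scale square_integrable_indicator Cons) auto
  then show ?case by (simp add: x)
qed

section \<open>Approximation by step functions in L^2 and its closure properties\<close>

lemma square_integrable_diff:
  assumes "square_integrable M f" "square_integrable M g"
  shows "square_integrable M (\<lambda>x. f x - g x)"
  using square_integrable_add[OF assms(1) square_integrable_scale[OF assms(2), of "-1"]] by simp

lemma square_integrableD:
  assumes "square_integrable M f"
  shows "f \<in> borel_measurable M" "integrable M (\<lambda>x. (f x)\<^sup>2)"
  using assms by (auto simp: square_integrable_def)

text \<open>A substitute for the triangle inequality that stays with squared distances, from 2ab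
  \<le> a^2 + b^2. Its factor 2 explains the choice of \<open>\<epsilon> / 4\<close> in the closure
  lemmas below.\<close>

lemma integral_square_add_le:
  assumes "square_integrable M f" "square_integrable M g"
  shows "(\<integral>x. (f x + g x)\<^sup>2 \<partial>M) \<le> 2 * (\<integral>x. (f x)\<^sup>2 \<partial>M) + 2 * (\<integral>x. (g x)\<^sup>2 \<partial>M)"
proof -
  have "(\<integral>x. (f x + g x)\<^sup>2 \<partial>M) \<le> (\<integral>x. 2 * (f x)\<^sup>2 + 2 * (g x)\<^sup>2 \<partial>M)"
  proof (rule integral_mono)
    show "integrable M (\<lambda>x. (f x + g x)\<^sup>2)"
      using square_integrable_add[OF assms] by (rule square_integrableD)
    show "(f x + g x)\<^sup>2 \<le> 2 * (f x)\<^sup>2 + 2 * (g x)\<^sup>2" for x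
      using sum_squares_bound[of "f x" "g x"] by (simp add: power2_sum)
  qed (use assms in \<open>auto simp: square_integrable_def\<close>)
  also have "\<dots> = 2 * (\<integral>x. (f x)\<^sup>2 \<partial>M) + 2 * (\<integral>x. (g x)\<^sup>2 \<partial>M)"
    using assms by (simp add: square_integrable_def)
  finally show ?thesis .
qed

text \<open>Membership in the L^2 closure of the step functions. Square integrability is part of the
  definition because the integral of a non-integrable function is 0 by convention, which would make
  the distance condition meaningless.\<close>

definition step_approximable :: "(real \<Rightarrow> real) \<Rightarrow> bool"
  where "step_approximable f \<longleftrightarrow> square_integrable \<U> f \<and>
    (\<forall>\<epsilon>>0. \<exists>p. valid_steps p \<and> (\<integral>t. (step_fun p t - f t)\<^sup>2 \<partial>\<U>) < \<epsilon>)"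

text \<open>The closure of a closure is the closure. Both limits of sequences and changes on a null
  set are instances.\<close>

lemma step_approximable_closed:
  assumes f: "square_integrable \<U> f"
    and g: "\<And>\<epsilon>. \<epsilon> > 0 \<Longrightarrow> \<exists>g. step_approximable g \<and> (\<integral>t. (g t - f t)\<^sup>2 \<partial>\<U>) < \<epsilon>"
  shows "step_approximable f"
  unfolding step_approximable_def
proof (intro conjI allI impI f)
  fix \<epsilon> :: real assume "\<epsilon> > 0"
  then have e: "\<epsilon> / 4 > 0" by simp
  from g[OF e] obtain g where g: "step_approximable g" "(\<integral>t. (g t - f t)\<^sup>2 \<partial>\<U>) < \<epsilon> / 4" by blast
  then obtain p where p: "valid_steps p" "(\<integral>t. (step_fun p t - g t)\<^sup>2 \<partial>\<U>) < \<epsilon> / 4"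
    using e unfolding step_approximable_def by blast
  have g': "square_integrable \<U> g" using g(1) by (simp add: step_approximable_def)
  have "(\<integral>t. ((step_fun p t - g t) + (g t - f t))\<^sup>2 \<partial>\<U>) \<le>
      2 * (\<integral>t. (step_fun p t - g t)\<^sup>2 \<partial>\<U>) + 2 * (\<integral>t. (g t - f t)\<^sup>2 \<partial>\<U>)"
    by (intro integral_square_add_le square_integrable_diff square_integrable_step_fun g' f)
  also have "\<dots> < \<epsilon>" using g(2) p(2) by linarith
  finally show "\<exists>p. valid_steps p \<and> (\<integral>t. (step_fun p t - f t)\<^sup>2 \<partial>\<U>) < \<epsilon>"
    using p(1) by auto
qed

lemma step_approximable_limit:
  assumes f: "square_integrable \<U> f" and g: "\<And>n. step_approximable (g n)"
    and lim: "(\<lambda>n. \<integral>t. (g n t - f t)\<^sup>2 \<partial>\<U>) \<longlonglongrightarrow> 0"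
  shows "step_approximable f"
proof (rule step_approximable_closed[OF f])
  fix \<epsilon> :: real assume "\<epsilon> > 0"
  then have "\<forall>\<^sub>F n in sequentially. (\<integral>t. (g n t - f t)\<^sup>2 \<partial>\<U>) < \<epsilon>"
    using lim by (rule order_tendstoD(2)[rotated])
  then show "\<exists>g. step_approximable g \<and> (\<integral>t. (g t - f t)\<^sup>2 \<partial>\<U>) < \<epsilon>"
    using g by (auto simp: eventually_sequentially)
qed

lemma step_approximable_step_fun: "valid_steps p \<Longrightarrow> step_approximable (step_fun p)"
  unfolding step_approximable_def by (auto intro!: square_integrable_step_fun exI[of _ p])

lemma step_approximable_cong_AE:
  assumes f: "step_approximable f" and eq: "AE t in \<U>. f t = g t"
  shows "step_approximable g"
proof (rule step_approximable_closed)
  have f': "square_integrable \<U> f" using f by (simp add: step_approximable_def)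
  show g: "square_integrable \<U> g"
    using square_integrable_lebesgue_on_cong_AE[OF _ f' eq] by simp
  have "(\<integral>t. (f t - g t)\<^sup>2 \<partial>\<U>) = (\<integral>t. 0 \<partial>\<U>)"
    using eq square_integrableD(1)[OF f'] square_integrableD(1)[OF g]
    by (intro integral_cong_AE) (auto elim: eventually_mono)
  then show "\<exists>h. step_approximable h \<and> (\<integral>t. (h t - g t)\<^sup>2 \<partial>\<U>) < \<epsilon>" if "\<epsilon> > 0" for \<epsilon>
    using that f by (intro exI[of _ f]) auto
qed

lemma step_approximable_scale:
  assumes "step_approximable f"
  shows "step_approximable (\<lambda>t. c * f t)"
  unfolding step_approximable_def
proof (intro conjI allI impI)
  show "square_integrable \<U> (\<lambda>t. c * f t)"
    using assms by (auto intro: square_integrable_scale simp: step_approximable_def)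
  fix \<epsilon> :: real assume "\<epsilon> > 0"
  \<comment> \<open>The added 1 keeps the denominator positive when \<open>c\<close> is 0.\<close>
  then have "\<epsilon> / (c\<^sup>2 + 1) > 0" by (simp add: add_nonneg_pos)
  then obtain p where p: "valid_steps p" "(\<integral>t. (step_fun p t - f t)\<^sup>2 \<partial>\<U>) < \<epsilon> / (c\<^sup>2 + 1)"
    using assms unfolding step_approximable_def by meson
  let ?q = "map (apfst ((*) c)) p"
  let ?E = "\<integral>t. (step_fun p t - f t)\<^sup>2 \<partial>\<U>"
  have "(\<integral>t. (step_fun ?q t - c * f t)\<^sup>2 \<partial>\<U>) = (\<integral>t. c\<^sup>2 * (step_fun p t - f t)\<^sup>2 \<partial>\<U>)"
    by (simp add: step_fun_scale right_diff_distrib[symmetric] power_mult_distrib)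
  also have "\<dots> = c\<^sup>2 * ?E" by simp
  also have "\<dots> \<le> (c\<^sup>2 + 1) * ?E"
    by (intro mult_right_mono integral_nonneg) auto
  also have "\<dots> < \<epsilon>"
    using p(2) by (simp add: pos_less_divide_eq add_nonneg_pos mult.commute)
  finally show "\<exists>p. valid_steps p \<and> (\<integral>t. (step_fun p t - c * f t)\<^sup>2 \<partial>\<U>) < \<epsilon>"
    using p(1) by (intro exI[of _ ?q]) (simp add: valid_steps_scale)
qed

lemma step_approximable_add:
  assumes "step_approximable f" "step_approximable g"
  shows "step_approximable (\<lambda>t. f t + g t)"
  unfolding step_approximable_def
proof (intro conjI allI impI)
  have fg: "square_integrable \<U> f" "square_integrable \<U> g"
    using assms by (auto simp: step_approximable_def)
  then show "square_integrable \<U> (\<lambda>t. f t + g t)"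
    by (rule square_integrable_add)
  fix \<epsilon> :: real assume "\<epsilon> > 0"
  then have e: "\<epsilon> / 4 > 0" by simp
  obtain p where p: "valid_steps p" "(\<integral>t. (step_fun p t - f t)\<^sup>2 \<partial>\<U>) < \<epsilon> / 4"
    using e assms(1) unfolding step_approximable_def by meson
  obtain q where q: "valid_steps q" "(\<integral>t. (step_fun q t - g t)\<^sup>2 \<partial>\<U>) < \<epsilon> / 4"
    using e assms(2) unfolding step_approximable_def by meson
  have "(\<integral>t. ((step_fun p t - f t) + (step_fun q t - g t))\<^sup>2 \<partial>\<U>) \<le>
      2 * (\<integral>t. (step_fun p t - f t)\<^sup>2 \<partial>\<U>) + 2 * (\<integral>t. (step_fun q t - g t)\<^sup>2 \<partial>\<U>)"
    by (intro integral_square_add_le square_integrable_diff square_integrable_step_fun fg)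
  also have "\<dots> < \<epsilon>" using p(2) q(2) by linarith
  \<comment> \<open>Concatenating two lists of steps adds the functions that they encode.\<close>
  finally show "\<exists>r. valid_steps r \<and> (\<integral>t. (step_fun r t - (f t + g t))\<^sup>2 \<partial>\<U>) < \<epsilon>"
    using p(1) q(1) by (intro exI[of _ "p @ q"]) (simp add: algebra_simps)
qed

lemma step_approximable_0: "step_approximable (\<lambda>_. 0)"
  using step_approximable_step_fun[of "[]"] by (simp add: step_fun_simps(1)[abs_def])

lemma step_approximable_sum:
  assumes "finite A" "\<And>i. i \<in> A \<Longrightarrow> step_approximable (f i)"
  shows "step_approximable (\<lambda>t. \<Sum>i\<in>A. f i t)"
  using assms by (induction A rule: finite_induct) (auto intro: step_approximable_add step_approximable_0)

section \<open>From intervals to Borel sets to square integrable functions\<close>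

lemma step_approximable_Ioc: "step_approximable (indicator {a<..b})"
proof (cases "max 0 a \<le> min 1 b")
  case True
  let ?p = "[(1, max 0 a, min 1 b)]"
  \<comment> \<open>Clipping to [0,1] can change the indicator only at the point 0, namely when
    \<open>a\<close> < 0 \<le> \<open>b\<close>: the clipped interval is open on the left.\<close>
  have "AE t in \<U>. step_fun ?p t = indicator {a<..b} t"
  proof (rule AE_I')
    show "{0} \<in> null_sets \<U>" by (simp add: null_sets_restrict_space)
  qed (auto split: split_indicator simp: indicator_def)
  then show ?thesis
    using True by (intro step_approximable_cong_AE[OF step_approximable_step_fun[of ?p]]) simp_all
next
  case False
  have "AE t in \<U>. 0 = indicat_real {a<..b} t"
    using False by (intro AE_I2) (auto simp: indicator_def)
  then show ?thesis
    by (rule step_approximable_cong_AE[OF step_approximable_0])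
qed

text \<open>Dynkin's pi-lambda argument: half-open intervals generate the Borel sets and are stable
  under intersection, and the sets with approximable indicator are closed under complements and
  countable disjoint unions.\<close>

lemma step_approximable_indicator:
  assumes "A \<in> sets borel"
  shows "step_approximable (indicator A)"
proof -
  let ?G = "range (\<lambda>(a, b). {a<..b::real})"
  have Pow: "?G \<subseteq> Pow UNIV" by simp
  have A: "A \<in> sigma_sets UNIV ?G"
    using assms by (simp add: borel_sigma_sets_Ioc)
  have "Int_stable ?G"
  proof (rule Int_stableI)
    fix C D assume "C \<in> ?G" "D \<in> ?G"
    then obtain a b c d where "C = {a<..b}" "D = {c<..d}" by auto
    then have "C \<inter> D = (\<lambda>(a, b). {a<..b}) (max a c, min b d)" by auto
    then show "C \<inter> D \<in> ?G" by blast
  qed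
  from this Pow A show ?thesis
  proof (induction rule: sigma_sets_induct_disjoint)
    case (basic A)
    then show ?case by (auto intro: step_approximable_Ioc)
  next
    case empty
    then show ?case using step_approximable_0 by (simp add: indicator_def[abs_def])
  next
    case (compl A)
    \<comment> \<open>The interval (-1,1] is half-open and contains [0,1], so its indicator plays
      the role of the constant 1.\<close>
    have "step_approximable (\<lambda>t. indicator {-1<..1} t + (-1) * indicator A t)"
      using compl by (intro step_approximable_add step_approximable_scale step_approximable_Ioc)
    then show ?case
      by (rule step_approximable_cong_AE) (auto intro!: AE_I2 simp: indicator_def)
  next
    case (union A)
    have A: "A i \<in> sets borel" for i
      using union(2) by (auto simp: borel_sigma_sets_Ioc)
    \<comment> \<open>By disjointness the partial sums are indicators of the finite unions; they
      converge pointwise, and the squared errors are dominated by 1.\<close>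
    let ?S = "\<lambda>n t. \<Sum>i<n. indicat_real (A i) t"
    have S: "?S n t = indicator (\<Union>i<n. A i) t" for n t
      using union(1) by (simp add: indicator_UN_disjoint disjoint_family_on_mono[OF subset_UNIV])
    show ?case
    proof (rule step_approximable_limit[where g = ?S])
      show "square_integrable \<U> (indicator (\<Union>(range A)))"
        using A by (intro square_integrable_indicator) auto
      show "step_approximable (?S n)" for n
        using union by (intro step_approximable_sum) auto
      have "(\<lambda>n. \<integral>t. (?S n t - indicator (\<Union>(range A)) t)\<^sup>2 \<partial>\<U>) \<longlonglongrightarrow> (\<integral>t. 0 \<partial>\<U>)"
      proof (rule integral_dominated_convergence[where w = "\<lambda>_. 1"])
        show "integrable \<U> (\<lambda>_. 1 :: real)"
          using finite_measure_unit_interval by (intro finite_measure.integrable_const)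
        show "(\<lambda>t. (?S n t - indicator (\<Union>(range A)) t)\<^sup>2) \<in> borel_measurable \<U>" for n
          by (rule borel_measurable_unitI) (use A in measurable)
        have "(\<lambda>n. ?S n t) \<longlonglongrightarrow> indicator (\<Union>(range A)) t" for t
          unfolding S by (rule LIMSEQ_indicator_UN)
        then have "(\<lambda>n. (?S n t - indicator (\<Union>(range A)) t)\<^sup>2) \<longlonglongrightarrow> 0" for t
          using tendsto_power[OF LIM_zero, of "\<lambda>n. ?S n t" "indicator (\<Union>(range A)) t" _ 2]
          by (simp only: zero_power2)
        then show "AE t in \<U>. (\<lambda>n. (?S n t - indicator (\<Union>(range A)) t)\<^sup>2) \<longlonglongrightarrow> 0"
          by (rule AE_I2)
        show "AE t in \<U>. norm ((?S n t - indicator (\<Union>(range A)) t)\<^sup>2) \<le> 1" for n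
          unfolding S by (intro AE_I2) (auto simp: indicator_def)
      qed simp
      then show "(\<lambda>n. \<integral>t. (?S n t - indicator (\<Union>(range A)) t)\<^sup>2 \<partial>\<U>) \<longlonglongrightarrow> 0" by simp
    qed
  qed
qed

theorem step_approximable_square_integrable:
  assumes f: "square_integrable \<U> f"
  shows "step_approximable f"
proof -
  \<comment> \<open>The function \<open>f\<close> is only Lebesgue measurable, while the indicator
    lemma concerns Borel sets; \<open>f\<close> is therefore replaced by a Borel function
    \<open>g\<close> that equals it almost everywhere on [0,1].\<close>
  have "(\<lambda>t. indicator {0..1} t *\<^sub>R f t) \<in> borel_measurable lebesgue"
    using square_integrableD(1)[OF f] by (subst (asm) borel_measurable_restrict_space_iff) auto
  from completion_ex_borel_measurable_real[OF this]
  obtain g where g: "g \<in> borel_measurable borel" "AE t in lborel. indicator {0..1} t *\<^sub>R f t = g t"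
    by auto
  from AE_completion[OF g(2)] have "AE t in \<U>. f t = g t"
    by (subst AE_restrict_space_iff) (auto elim!: eventually_mono)
  then have gf: "AE t in \<U>. g t = f t" and sq: "square_integrable \<U> g"
    using square_integrable_lebesgue_on_cong_AE[OF _ f] by (auto elim: eventually_mono)
  obtain F where F: "\<And>i. simple_function borel (F i)" "\<And>x. (\<lambda>i. F i x) \<longlonglongrightarrow> g x"
      "\<And>i x. \<bar>F i x\<bar> \<le> 2 * \<bar>g x\<bar>"
    using borel_measurable_implies_sequence_metric[OF g(1), of 0] by auto
  have meas [measurable]: "F i \<in> borel_measurable \<U>" "g \<in> borel_measurable \<U>" for i
    using g(1) F(1) by (blast intro: borel_measurable_unitI borel_measurable_simple_function)+
  have "step_approximable g"
  proof (rule step_approximable_limit[OF sq])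
    show "step_approximable (F i)" for i
    proof -
      have "step_approximable (\<lambda>t. \<Sum>y\<in>range (F i). y * indicator (F i -` {y}) t)"
        using simple_functionD[OF F(1)[of i]]
        by (intro step_approximable_sum step_approximable_scale step_approximable_indicator) auto
      moreover have "F i = (\<lambda>t. \<Sum>y\<in>range (F i). y * indicator (F i -` {y}) t)"
        using simple_function_indicator_representation_banach[OF F(1)[of i]]
        unfolding space_borel Int_UNIV_right real_scaleR_def mult.commute[of "indicator _ _"]
        by (intro ext) blast
      ultimately show ?thesis by simp
    qed
    have "(\<lambda>i. \<integral>t. (F i t - g t)\<^sup>2 \<partial>\<U>) \<longlonglongrightarrow> (\<integral>t. 0 \<partial>\<U>)"
    \<comment> \<open>The bound |F| \<le> 2|g| gives |F - g| \<le> 3|g|, whence the factor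
      9.\<close>
    proof (rule integral_dominated_convergence[where w = "\<lambda>t. 9 * (g t)\<^sup>2"])
      show "integrable \<U> (\<lambda>t. 9 * (g t)\<^sup>2)"
        using sq by (simp add: square_integrable_def)
      have "(\<lambda>i. (F i t - g t)\<^sup>2) \<longlonglongrightarrow> 0" for t
        using tendsto_power[OF tendsto_diff[OF F(2)[of t] tendsto_const], of "g t" 2] by simp
      then show "AE t in \<U>. (\<lambda>i. (F i t - g t)\<^sup>2) \<longlonglongrightarrow> 0" by simp
      have "norm ((F i t - g t)\<^sup>2) \<le> 9 * (g t)\<^sup>2" for i t
      proof -
        have "\<bar>F i t - g t\<bar> \<le> \<bar>3 * g t\<bar>" using F(3)[of i t] by linarith
        then have "(F i t - g t)\<^sup>2 \<le> (3 * g t)\<^sup>2" by (simp only: abs_le_square_iff)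
        then show ?thesis by (simp add: power_mult_distrib)
      qed
      then show "AE t in \<U>. norm ((F i t - g t)\<^sup>2) \<le> 9 * (g t)\<^sup>2" for i by simp
    qed measurable
    then show "(\<lambda>i. \<integral>t. (F i t - g t)\<^sup>2 \<partial>\<U>) \<longlonglongrightarrow> 0" by simp
  qed
  then show ?thesis using gf by (rule step_approximable_cong_AE)
qed

section \<open>The reproducing kernel of the Cameron--Martin space\<close>

lemma AE_cm_deriv_add: "AE t in \<U>. cm_deriv (h + k) t = cm_deriv h t + cm_deriv k t"
proof -
  have "AE t in \<U>. cm_deriv h t + cm_deriv k t = cm_deriv (h + k) t"
    unfolding cm_deriv_def by transfer (simp add: cm_space_add(2))
  then show ?thesis by eventually_elim simp
qed

lemma AE_cm_deriv_scaleR: "AE t in \<U>. cm_deriv (r *\<^sub>R h) t = r * cm_deriv h t"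
proof -
  have "AE t in \<U>. r * cm_deriv h t = cm_deriv (r *\<^sub>R h) t"
    unfolding cm_deriv_def by transfer (simp add: cm_space_scale(2))
  then show ?thesis by eventually_elim simp
qed

lemma AE_cm_deriv_diff: "AE t in \<U>. cm_deriv (h - k) t = cm_deriv h t - cm_deriv k t"
  unfolding minus_cameron_martin_def
  using AE_cm_deriv_add[of h "(-1) *\<^sub>R k"] AE_cm_deriv_scaleR[of "-1" k]
  by eventually_elim simp

definition kernel_fun :: "real \<Rightarrow> real \<Rightarrow> real"
  where "kernel_fun t s = (if s \<in> {0..1} then min s t else 0)"

text \<open>The function s \<mapsto> min s t is 1-Lipschitz on [0,1], so \<delta> = \<epsilon>
  serves.\<close>

lemma abs_cont_on_kernel_fun: "abs_cont_on 0 1 (kernel_fun t)"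
  unfolding abs_cont_on_def
proof (intro allI impI)
  fix \<epsilon> :: real assume "\<epsilon> > 0"
  have "(\<Sum>K\<in>D. \<bar>kernel_fun t (Sup K) - kernel_fun t (Inf K)\<bar>) < \<epsilon>"
    if D: "D division_of \<Union>D" "\<Union>D \<subseteq> {0..1}" "(\<Sum>K\<in>D. Sup K - Inf K) < \<epsilon>" for D
  proof -
    have "(\<Sum>K\<in>D. \<bar>kernel_fun t (Sup K) - kernel_fun t (Inf K)\<bar>) \<le> (\<Sum>K\<in>D. Sup K - Inf K)"
    proof (rule sum_mono)
      fix K assume K: "K \<in> D"
      obtain u v where uv: "K = cbox u v" using division_ofD(4)[OF D(1) K] by blast
      have "K \<noteq> {}" "K \<subseteq> {0..1}" using division_ofD(3)[OF D(1) K] D(2) K by auto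
      with uv have "K = {u..v}" "u \<le> v" "0 \<le> u" "v \<le> 1" by auto
      then show "\<bar>kernel_fun t (Sup K) - kernel_fun t (Inf K)\<bar> \<le> Sup K - Inf K"
        by (simp add: kernel_fun_def)
    qed
    then show ?thesis using D(3) by linarith
  qed
  with \<open>\<epsilon> > 0\<close> show "\<exists>\<delta>>0. \<forall>D. D division_of \<Union>D \<and> \<Union>D \<subseteq> {0..1} \<and> (\<Sum>K\<in>D. Sup K - Inf K) < \<delta>
      \<longrightarrow> (\<Sum>K\<in>D. \<bar>kernel_fun t (Sup K) - kernel_fun t (Inf K)\<bar>) < \<epsilon>"
    by blast
qed

lemma AE_has_derivative_kernel_fun:
  "AE s in \<U>. (kernel_fun t has_real_derivative indicator {0<..t} s) (at s)"
proof (rule AE_I')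
  \<comment> \<open>The derivative at \<open>s\<close> is two-sided. It can fail at
    \<open>t\<close>, where the minimum has its corner, and at 0 and 1, where the extension by zero
    takes over.\<close>
  show "{0, t, 1} \<inter> {0..1} \<in> null_sets \<U>"
    by (auto simp: null_sets_restrict_space intro: finite_imp_null_set_lborel null_sets_completionI)
  have "(kernel_fun t has_real_derivative indicator {0<..t} s) (at s)"
    if s: "s \<in> {0..1}" "s \<notin> {0, t, 1}" for s
  proof (cases "s < t")
    case True
    have "((\<lambda>s. s) has_real_derivative 1) (at s)" by (rule DERIV_ident)
    moreover have "open {0<..<min t 1}" "s \<in> {0<..<min t 1}" using s True by auto
    ultimately have "(kernel_fun t has_real_derivative 1) (at s)"
      by (rule has_field_derivative_transform_within_open) (auto simp: kernel_fun_def)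
    then show ?thesis using s True by simp
  next
    case False
    have "((\<lambda>s. t) has_real_derivative 0) (at s)" by (rule DERIV_const)
    moreover have "open {max 0 t<..<1}" "s \<in> {max 0 t<..<1}" using s False by auto
    ultimately have "(kernel_fun t has_real_derivative 0) (at s)"
      by (rule has_field_derivative_transform_within_open) (auto simp: kernel_fun_def)
    then show ?thesis using s False by simp
  qed
  then show "{s \<in> space \<U>. \<not> (kernel_fun t has_real_derivative indicator {0<..t} s) (at s)} \<subseteq>
      {0, t, 1} \<inter> {0..1}"
    by auto
qed

lemma AE_deriv_kernel_fun: "AE s in \<U>. deriv (kernel_fun t) s = indicator {0<..t} s"
  using AE_has_derivative_kernel_fun by eventually_elim (rule DERIV_imp_deriv)

definition kernel :: "real \<Rightarrow> cameron_martin"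
  where "kernel t = Abs_cm (kernel_fun t)"

lemma cm_fun_kernel: "0 \<le> t \<Longrightarrow> cm_fun (kernel t) = kernel_fun t"
  unfolding kernel_def
proof (rule Abs_cm_inverse, simp, intro conjI)
  assume "0 \<le> t"
  show "abs_cont_on 0 1 (kernel_fun t)" by (rule abs_cont_on_kernel_fun)
  show "kernel_fun t 0 = 0" using \<open>0 \<le> t\<close> by (simp add: kernel_fun_def)
  show "\<forall>s. (0 \<le> s \<longrightarrow> \<not> s \<le> 1) \<longrightarrow> kernel_fun t s = 0" by (auto simp: kernel_fun_def)
  show "AE s in \<U>. kernel_fun t differentiable (at s)"
    using AE_has_derivative_kernel_fun[of t]
    by eventually_elim (auto simp: real_differentiable_def)
  have "AE s in \<U>. indicator {0<..t} s = deriv (kernel_fun t) s"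
    using AE_deriv_kernel_fun[of t] by eventually_elim simp
  then show "square_integrable \<U> (deriv (kernel_fun t))"
    by (rule square_integrable_lebesgue_on_cong_AE[rotated 2])
       (auto intro: square_integrable_indicator)
qed

lemma AE_cm_deriv_kernel: "0 \<le> t \<Longrightarrow> AE s in \<U>. cm_deriv (kernel t) s = indicator {0<..t} s"
  using AE_deriv_kernel_fun[of t] by (simp add: cm_deriv_def cm_fun_kernel)

lemma cm_deriv_measurable [measurable]: "cm_deriv h \<in> borel_measurable \<U>"
  using square_integrable_cm_deriv by (rule square_integrableD)

lemma integrable_cm_deriv: "integrable \<U> (cm_deriv h)"
proof -
  have "square_integrable \<U> (\<lambda>_. 1)" by (rule square_integrable_unit_bounded[where B = 1]) auto
  from square_integrable_mult[OF this square_integrable_cm_deriv] show ?thesis by simp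
qed

text \<open>The fundamental theorem yields a Henstock-Kurzweil integral; it agrees with the Lebesgue
  integral because a square integrable function on [0,1] is integrable.\<close>

lemma set_integral_cm_deriv:
  assumes "0 \<le> a" "a \<le> b" "b \<le> 1"
  shows "(LINT t:{a..b}|lebesgue. cm_deriv h t) = cm_fun h b - cm_fun h a"
proof -
  have "set_integrable lebesgue {0..1} (cm_deriv h)"
    using integrable_cm_deriv unfolding set_integrable_def
    by (subst (asm) integrable_restrict_space) auto
  then have "set_integrable lebesgue {a..b} (cm_deriv h)"
    by (rule set_integrable_subset) (use assms in auto)
  from set_lebesgue_integral_eq_integral(2)[OF this] show ?thesis
    using integral_unique[OF has_integral_cm_deriv[OF assms]] by simp
qed

text \<open>The reproducing property: pairing with the indicator of (0,t] integrates the derivative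
  of \<open>h\<close> from 0 to \<open>t\<close>, and h(0) = 0.\<close>

lemma inner_kernel:
  assumes "0 \<le> t" "t \<le> 1"
  shows "inner (kernel t) h = cm_fun h t"
proof -
  have "inner (kernel t) h = (\<integral>s. indicator {0..t} s * cm_deriv h s \<partial>\<U>)"
    unfolding inner_cameron_martin_def
  proof (rule integral_cong_AE)
    \<comment> \<open>Discarding the point 0 turns the half-open interval of the kernel derivative
      into the closed one of \<open>set_integral_cm_deriv\<close>.\<close>
    have "AE s in \<U>. s \<noteq> 0"
      by (rule AE_I'[of "{0}"]) (auto simp: null_sets_restrict_space)
    with AE_cm_deriv_kernel[OF assms(1)]
    show "AE s in \<U>. cm_deriv (kernel t) s * cm_deriv h s = indicator {0..t} s * cm_deriv h s"
      by eventually_elim (auto simp: indicator_def)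
    show "(\<lambda>s. indicator {0..t} s * cm_deriv h s) \<in> borel_measurable \<U>"
      by (intro borel_measurable_times borel_measurable_unitI cm_deriv_measurable) auto
  qed measurable
  also have "\<dots> = (\<integral>s. indicator {0..1} s * (indicator {0..t} s * cm_deriv h s) \<partial>lebesgue)"
    by (subst integral_restrict_space) auto
  also have "\<dots> = (LINT s:{0..t}|lebesgue. cm_deriv h s)"
    unfolding set_lebesgue_integral_def
    using assms by (intro Bochner_Integration.integral_cong) (auto simp: indicator_def)
  also have "\<dots> = cm_fun h t"
    using set_integral_cm_deriv[of 0 t h] assms by (simp add: cm_fun_0)
  finally show ?thesis .
qed

lemma cm_fun_add: "cm_fun (h + k) t = cm_fun h t + cm_fun k t"
  by transfer simp

lemma cm_fun_scaleR: "cm_fun (r *\<^sub>R h) t = r * cm_fun h t"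
  by transfer simp

lemma cm_fun_diff: "cm_fun (h - k) t = cm_fun h t - cm_fun k t"
  unfolding minus_cameron_martin_def cm_fun_add cm_fun_scaleR by simp

section \<open>Density of the linear combinations of kernels\<close>

definition cm_step :: "(real \<times> real \<times> real) list \<Rightarrow> cameron_martin"
  where "cm_step p = (\<Sum>(a, u, v)\<leftarrow>p. a *\<^sub>R (kernel v - kernel u))"

text \<open>The derivative of \<open>kernel v - kernel u\<close> is the indicator of (u,v], so
  \<open>cm_step p\<close> is the primitive of \<open>step_fun p\<close>.\<close>

lemma AE_cm_deriv_step: "valid_steps p \<Longrightarrow> AE t in \<U>. cm_deriv (cm_step p) t = step_fun p t"
proof (induction p)
  case Nil
  have "cm_deriv 0 t = 0" for t unfolding cm_deriv_def by transfer simp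
  then show ?case by (simp add: cm_step_def)
next
  case (Cons x p)
  obtain a u v where x: "x = (a, u, v)" by (cases x)
  have uv: "0 \<le> u" "u \<le> v" "valid_steps p" using Cons.prems by (auto simp: x)
  have ind: "indicat_real {u<..v} t = indicator {0<..v} t - indicator {0<..u} t" for t
    using uv by (auto simp: indicator_def)
  have step: "cm_step (x # p) = a *\<^sub>R (kernel v - kernel u) + cm_step p"
    by (simp add: cm_step_def x)
  show ?case
    unfolding step
    using Cons.IH[OF uv(3)] AE_cm_deriv_kernel[OF uv(1)] AE_cm_deriv_kernel[OF order_trans[OF uv(1,2)]]
      AE_cm_deriv_add[of "a *\<^sub>R (kernel v - kernel u)" "cm_step p"]
      AE_cm_deriv_scaleR[of a "kernel v - kernel u"] AE_cm_deriv_diff[of "kernel v" "kernel u"]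
    by eventually_elim (simp only: x step_fun_simps ind)
qed

text \<open>Differentiation is an isometry from the Cameron-Martin space into L^2[0,1], so
  approximating the derivative by step functions approximates \<open>h\<close> itself.\<close>

theorem cm_step_dense: "\<exists>p. (\<forall>n. valid_steps (p n)) \<and> (\<lambda>n. cm_step (p n)) \<longlonglongrightarrow> h"
proof -
  have "step_approximable (cm_deriv h)"
    by (intro step_approximable_square_integrable square_integrable_cm_deriv)
  then have "\<exists>p. valid_steps p \<and> (\<integral>t. (step_fun p t - cm_deriv h t)\<^sup>2 \<partial>\<U>) < inverse (real (Suc n))" for n
    unfolding step_approximable_def by simp
  then obtain p where p: "\<And>n. valid_steps (p n)"
      "\<And>n. (\<integral>t. (step_fun (p n) t - cm_deriv h t)\<^sup>2 \<partial>\<U>) < inverse (real (Suc n))"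
    by metis
  have eq: "(norm (cm_step (p n) - h))\<^sup>2 = (\<integral>t. (step_fun (p n) t - cm_deriv h t)\<^sup>2 \<partial>\<U>)" for n
    unfolding power2_norm_eq_inner inner_cameron_martin_def
  proof (rule integral_cong_AE)
    show "AE t in \<U>. cm_deriv (cm_step (p n) - h) t * cm_deriv (cm_step (p n) - h) t =
        (step_fun (p n) t - cm_deriv h t)\<^sup>2"
      using AE_cm_deriv_step[OF p(1)[of n]] AE_cm_deriv_diff[of "cm_step (p n)" h]
      by eventually_elim (simp add: power2_eq_square)
    show "(\<lambda>t. (step_fun (p n) t - cm_deriv h t)\<^sup>2) \<in> borel_measurable \<U>"
      using square_integrableD(1)[OF square_integrable_step_fun[of "p n"]] by measurable
  qed measurable
  have "(\<lambda>n. (norm (cm_step (p n) - h))\<^sup>2) \<longlonglongrightarrow> 0"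
    by (rule tendsto_sandwich[OF _ _ tendsto_const LIMSEQ_inverse_real_of_nat])
       (auto simp: eq intro!: eventuallyI less_imp_le[OF p(2)] integral_nonneg simp del: of_nat_Suc)
  then have "(\<lambda>n. norm (cm_step (p n) - h)) \<longlonglongrightarrow> 0"
    using tendsto_real_sqrt by fastforce
  then have "(\<lambda>n. cm_step (p n)) \<longlonglongrightarrow> h"
    by (rule LIM_zero_cancel[OF tendsto_norm_zero_cancel])
  with p(1) show ?thesis by blast
qed

section \<open>The point evaluations as elements of the dual space\<close>

lemma abs_path_le_norm: "\<bar>path_fun \<omega> t\<bar> \<le> norm \<omega>"
proof (cases "t \<in> {0..1}")
  case True
  then show ?thesis
    unfolding norm_wiener_space_def using path_bdd_above by (rule cSUP_upper)
qed (simp add: path_outside)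

lemma bounded_linear_path_fun: "bounded_linear (\<lambda>\<omega>. path_fun \<omega> t)"
proof (rule bounded_linear_intro[where K = 1])
  show "path_fun (x + y) t = path_fun x t + path_fun y t" for x y by transfer simp
  show "path_fun (r *\<^sub>R x) t = r *\<^sub>R path_fun x t" for r x by transfer simp
qed (simp add: abs_path_le_norm)

lemma borel_measurable_bounded_linear:
  assumes "bounded_linear \<phi>" "sets M = sets borel"
  shows "\<phi> \<in> borel_measurable M"
  using borel_measurable_continuous_onI[OF linear_continuous_on[OF assms(1)]] assms(2)
  by (simp cong: measurable_cong_sets)

lemma square_integrable_path_fun:
  assumes \<mu>: "wiener_measure \<mu>" and t: "0 \<le> t" "t \<le> 1"
  shows "square_integrable \<mu> (\<lambda>\<omega>. path_fun \<omega> t)"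
\<comment> \<open>The law of the increment from time 0 to \<open>t\<close> is specified only for 0 <
  \<open>t\<close>; at 0 the evaluation vanishes.\<close>
proof (cases "t = 0")
  case True
  then show ?thesis by (simp add: path_0 square_integrable_def)
next
  case False
  then have "distributed \<mu> lborel (\<lambda>\<omega>. path_fun \<omega> t - path_fun \<omega> 0) (normal_density 0 (sqrt (t - 0)))"
    using \<mu> t unfolding wiener_measure_def by (elim conjE allE[of _ 0] allE[of _ t]) simp
  then have D: "distributed \<mu> lborel (\<lambda>\<omega>. path_fun \<omega> t) (normal_density 0 (sqrt t))"
    by (simp add: path_0)
  have "integrable \<mu> (\<lambda>\<omega>. (path_fun \<omega> t)\<^sup>2)"
    using distributed_integrable[OF D, of "\<lambda>x. x\<^sup>2"] integrable_normal_moment[of "sqrt t" 0 2] False t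
    by simp
  moreover have "(\<lambda>\<omega>. path_fun \<omega> t) \<in> borel_measurable \<mu>"
    using bounded_linear_path_fun \<mu> by (auto intro: borel_measurable_bounded_linear simp: wiener_measure_def)
  ultimately show ?thesis by (simp add: square_integrable_def)
qed

text \<open>The derivative is already a step function, so a constant approximating sequence has
  error 0 on both sides. The factor \<open>r\<close> is carried along to supply characteristic
  functions on the line through \<open>kernel t\<close>.\<close>

lemma is_dual_version_kernel:
  assumes \<mu>: "wiener_measure \<mu>" and t: "0 \<le> t" "t \<le> 1"
  shows "is_dual_version \<mu> (r *\<^sub>R kernel t) (\<lambda>\<omega>. r * path_fun \<omega> t)"
  unfolding is_dual_version_def is_wiener_integral_def
proof (intro conjI exI)
  show "bounded_linear (\<lambda>\<omega>. r * path_fun \<omega> t)"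
    by (rule bounded_linear_const_mult[OF bounded_linear_path_fun])
  show "square_integrable \<mu> (\<lambda>\<omega>. r * path_fun \<omega> t)"
    by (rule square_integrable_scale[OF square_integrable_path_fun[OF assms]])
  let ?p = "\<lambda>n::nat. [(r, 0, t)]"
  show "\<forall>n. \<forall>(a, u, v)\<in>set (?p n). 0 \<le> u \<and> u \<le> v \<and> v \<le> 1" using t by simp
  have "(\<integral>s. (step_fun [(r, 0, t)] s - cm_deriv (r *\<^sub>R kernel t) s)\<^sup>2 \<partial>\<U>) = (\<integral>s. 0 \<partial>\<U>)"
  proof (rule integral_cong_AE)
    show "AE s in \<U>. (step_fun [(r, 0, t)] s - cm_deriv (r *\<^sub>R kernel t) s)\<^sup>2 = 0"
      using AE_cm_deriv_scaleR[of r "kernel t"] AE_cm_deriv_kernel[OF t(1)]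
      by eventually_elim simp
    show "(\<lambda>s. (step_fun [(r, 0, t)] s - cm_deriv (r *\<^sub>R kernel t) s)\<^sup>2) \<in> borel_measurable \<U>"
      using square_integrableD(1)[OF square_integrable_step_fun[of "[(r, 0, t)]"]] by measurable
  qed simp
  then show "(\<lambda>n. \<integral>s. (step_fun (?p n) s - cm_deriv (r *\<^sub>R kernel t) s)\<^sup>2 \<partial>\<U>) \<longlonglongrightarrow> 0" by simp
  show "(\<lambda>n. \<integral>\<omega>. (step_integral (?p n) \<omega> - r * path_fun \<omega> t)\<^sup>2 \<partial>\<mu>) \<longlonglongrightarrow> 0"
    by (simp add: step_integral_def path_0)
qed

section \<open>Paths pinned at finitely many times\<close>

text \<open>Pythagoras: |y|^2 = |x|^2 + |y - x|^2 on \<open>L\<close> shows that \<open>x\<close> is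
  a minimiser and that any other minimiser is at distance 0 from it.\<close>

lemma nearest_to_0_eqI:
  assumes "x \<in> L" "\<And>y. y \<in> L \<Longrightarrow> inner x (y - x) = 0"
  shows "nearest_to_0 L = x"
  unfolding nearest_to_0_def
proof (rule the_equality)
  have pyth: "(norm y)\<^sup>2 = (norm x)\<^sup>2 + (norm (y - x))\<^sup>2" if "y \<in> L" for y
    using assms(2)[OF that] unfolding power2_norm_eq_inner
    by (simp add: inner_diff_left inner_diff_right inner_commute)
  have "norm x \<le> norm y" if "y \<in> L" for y
    by (rule power2_le_imp_le) (simp_all add: pyth[OF that])
  with assms(1) show "x \<in> L \<and> (\<forall>y\<in>L. norm x \<le> norm y)" by blast
  fix z assume z: "z \<in> L \<and> (\<forall>y\<in>L. norm z \<le> norm y)"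
  then have "(norm z)\<^sup>2 \<le> (norm x)\<^sup>2" using assms(1) by (simp add: power_mono)
  with pyth[of z] z have "(norm (z - x))\<^sup>2 \<le> 0" by simp
  then show "z = x" by simp
qed

text \<open>Two candidates differ by an element of \<open>V\<close>, by closure under differences;
  subtracting their orthogonality relations makes that difference orthogonal to itself.\<close>

lemma orth_proj_eqI:
  assumes "p \<in> V" "\<And>q. q \<in> V \<Longrightarrow> inner (x - p) q = 0"
    and diff: "\<And>q r. q \<in> V \<Longrightarrow> r \<in> V \<Longrightarrow> q - r \<in> V"
  shows "orth_proj V x = p"
  unfolding orth_proj_def
proof (rule the_equality)
  show "p \<in> V \<and> (\<forall>q\<in>V. inner (x - p) q = 0)" using assms by blast
  fix z assume z: "z \<in> V \<and> (\<forall>q\<in>V. inner (x - z) q = 0)"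
  then have "inner (x - p) (z - p) = 0" "inner (x - z) (z - p) = 0"
    using assms by auto
  then have "inner (z - p) (z - p) = 0"
    by (simp add: inner_diff_left)
  then show "z = p" by simp
qed

text \<open>
  The piecewise linear path through the points \<open>(T k, c k)\<close>, constant after \<open>T m\<close>. With
  \<open>T 0 = c 0 = 0\<close> the first interval needs no separate treatment.
\<close>

definition interpolant :: "nat \<Rightarrow> (nat \<Rightarrow> real) \<Rightarrow> (nat \<Rightarrow> real) \<Rightarrow> cameron_martin"
  where "interpolant m T c =
    (\<Sum>k=1..m. ((c k - c (k - 1)) / (T k - T (k - 1))) *\<^sub>R (kernel (T k) - kernel (T (k - 1))))"

section \<open>Interpolation and projection on a finite grid of times\<close>

locale grid =
  fixes m :: nat and T :: "nat \<Rightarrow> real"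
  assumes T0: "T 0 = 0" and Tm: "T m \<le> 1" and step: "\<And>k. k < m \<Longrightarrow> T k < T (Suc k)"
begin

lemma T_mono: "i \<le> j \<Longrightarrow> j \<le> m \<Longrightarrow> T i \<le> T j"
proof (induction j rule: dec_induct)
  case (step n)
  then show ?case using grid.step[OF grid_axioms, of n] by simp
qed simp

lemma T_range: "k \<le> m \<Longrightarrow> 0 \<le> T k" "k \<le> m \<Longrightarrow> T k \<le> 1"
  using T_mono[of 0 k] T_mono[of k m] T0 Tm by auto

lemma inner_interpolant:
  "inner (interpolant m T c) h =
    (\<Sum>k=1..m. (c k - c (k - 1)) / (T k - T (k - 1)) * (cm_fun h (T k) - cm_fun h (T (k - 1))))"
  unfolding interpolant_def inner_sum_left
  by (intro sum.cong) (auto simp: inner_diff_left inner_kernel T_range)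

lemma cm_fun_interpolant:
  assumes c0: "c 0 = 0" and j: "j \<le> m"
  shows "cm_fun (interpolant m T c) (T j) = c j"
proof -
  have "cm_fun (interpolant m T c) (T j) = inner (interpolant m T c) (kernel (T j))"
    using j by (simp add: inner_kernel[symmetric] T_range inner_commute)
  \<comment> \<open>Over a grid cell, min(s, T j) grows by the full length of the cell up to index
    \<open>j\<close> and is constant afterwards; the quotients cancel and the sum
    telescopes.\<close>
  also have "\<dots> = (\<Sum>k=1..m. if k \<le> j then c k - c (k - 1) else 0)"
    unfolding inner_interpolant
  proof (intro sum.cong refl)
    fix k assume k: "k \<in> {1..m}"
    then obtain i where i: "k = Suc i" by (cases k) auto
    have "T i < T k" using step[of i] k i by simp
    moreover have "T k \<le> T j" if "k \<le> j" using T_mono[OF that j] .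
    moreover have "T j \<le> T i" if "\<not> k \<le> j" using T_mono[of j i] that k i by simp
    ultimately show "(c k - c (k - 1)) / (T k - T (k - 1)) *
        (cm_fun (kernel (T j)) (T k) - cm_fun (kernel (T j)) (T (k - 1))) =
        (if k \<le> j then c k - c (k - 1) else 0)"
      using k i j T_range by (auto simp: cm_fun_kernel kernel_fun_def min_def)
  qed
  also have "\<dots> = (\<Sum>k\<in>{1..j}. c k - c (k - 1))"
    using j by (intro sum.mono_neutral_cong_right) auto
  also have "\<dots> = c j"
    using sum_telescope''[of 0 j c] c0 by (simp add: atLeastSucAtMost_greaterThanAtMost[symmetric])
  finally show ?thesis .
qed

lemma pinned_eq: "pinned m T c = {h. \<forall>k\<in>{1..m}. inner (kernel (T k)) h = c k}"
  by (auto simp: pinned_def inner_kernel T_range)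

lemma closed_pinned: "closed (pinned m T c)"
proof -
  have "pinned m T c = (\<Inter>k\<in>{1..m}. {h. inner (kernel (T k)) h = c k})"
    by (auto simp: pinned_eq)
  then show ?thesis
    by (auto intro!: closed_INT closed_Collect_eq continuous_intros)
qed

lemma affine_pinned: "affine (pinned m T c)"
  unfolding affine_def pinned_eq
  by (auto simp: inner_add_right distrib_right[symmetric])

lemma interpolant_in_pinned: "c 0 = 0 \<Longrightarrow> interpolant m T c \<in> pinned m T c"
  by (simp add: pinned_def cm_fun_interpolant)

text \<open>The interpolant is a combination of kernels at grid times, hence orthogonal to all paths
  that vanish there. Both the nearest point and the projection rest on this.\<close>

lemma inner_interpolant_eq_0:
  assumes "\<And>k. k \<in> {1..m} \<Longrightarrow> cm_fun h (T k) = 0"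
  shows "inner (interpolant m T c) h = 0"
proof -
  have "cm_fun h (T k) = 0" if "k \<le> m" for k
    using assms[of k] that by (cases "k = 0") (auto simp: T0 cm_fun_0)
  then show ?thesis by (auto simp: inner_interpolant intro!: sum.neutral)
qed

lemma nearest_to_0_pinned:
  assumes "c 0 = 0"
  shows "nearest_to_0 (pinned m T c) = interpolant m T c"
proof (rule nearest_to_0_eqI[OF interpolant_in_pinned[of c, OF assms]])
  fix y assume "y \<in> pinned m T c"
  then show "inner (interpolant m T c) (y - interpolant m T c) = 0"
    by (intro inner_interpolant_eq_0) (simp add: cm_fun_diff cm_fun_interpolant assms pinned_def)
qed

lemma direction_pinned:
  assumes "c 0 = 0"
  shows "direction (pinned m T c) = {h. \<forall>k\<in>{1..m}. cm_fun h (T k) = 0}"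
proof -
  have "h \<in> direction (pinned m T c) \<longleftrightarrow> h + interpolant m T c \<in> pinned m T c" for h
    unfolding direction_def nearest_to_0_pinned[of c, OF assms]
    by (auto simp: image_iff intro!: bexI[of _ "h + interpolant m T c"])
  then show ?thesis
    by (auto simp: pinned_def cm_fun_add cm_fun_interpolant[of c, OF assms])
qed

text \<open>Removing from \<open>h\<close> the interpolant of its own grid values leaves a path that
  vanishes on the grid, and the removed part is orthogonal to all such paths.\<close>

lemma orth_proj_pinned:
  assumes "c 0 = 0"
  shows "orth_proj (direction (pinned m T c)) h = h - interpolant m T (\<lambda>k. cm_fun h (T k))"
proof (rule orth_proj_eqI; unfold direction_pinned[of c, OF assms])
  show "h - interpolant m T (\<lambda>k. cm_fun h (T k)) \<in> {h. \<forall>k\<in>{1..m}. cm_fun h (T k) = 0}"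
    by (simp add: cm_fun_diff cm_fun_interpolant T0 cm_fun_0)
next
  fix q assume "q \<in> {h. \<forall>k\<in>{1..m}. cm_fun h (T k) = 0}"
  then show "inner (h - (h - interpolant m T (\<lambda>k. cm_fun h (T k)))) q = 0"
    using inner_interpolant_eq_0[of q "\<lambda>k. cm_fun h (T k)"] by simp
qed (simp add: cm_fun_diff)

text \<open>Read off from the explicit formula. It makes the variance along
  \<open>s *\<^sub>R kernel t\<close> proportional to \<open>s\<^sup>2\<close>.\<close>

lemma orth_proj_pinned_scaleR:
  assumes "c 0 = 0"
  shows "orth_proj (direction (pinned m T c)) (r *\<^sub>R h) = r *\<^sub>R orth_proj (direction (pinned m T c)) h"
  unfolding orth_proj_pinned[of c, OF assms] interpolant_def
  by (simp add: cm_fun_scaleR scaleR_right_diff_distrib[of r] scaleR_sum_right right_diff_distrib[symmetric])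

end

section \<open>Means under the conditioned measure\<close>

text \<open>Comparing imaginary parts, divided by \<open>s\<close>, as \<open>s \<rightarrow> 0\<close>.\<close>

lemma deriv_char_mean:
  fixes a v e C :: real
  assumes bound: "\<And>s. cmod (exp (\<i> * of_real (s * a) - of_real (s\<^sup>2 * v)) - 1 - \<i> * of_real (s * e)) \<le> C * s\<^sup>2"
  shows "e = a"
proof -
  have Im: "\<bar>exp (- (s\<^sup>2 * v)) * sin (s * a) - s * e\<bar> \<le> C * s\<^sup>2" for s
  proof -
    have "Im (exp (\<i> * of_real (s * a) - of_real (s\<^sup>2 * v)) - 1 - \<i> * of_real (s * e)) =
        exp (- (s\<^sup>2 * v)) * sin (s * a) - s * e"
      by (simp add: Im_exp)
    then show ?thesis using order_trans[OF abs_Im_le_cmod bound[of s]] by simp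
  qed
  let ?f = "\<lambda>s::real. exp (- (s\<^sup>2 * v)) * sin (s * a)"
  have "(?f has_real_derivative a) (at 0)"
    by (auto intro!: derivative_eq_intros)
  then have lim1: "(\<lambda>s. ?f s / s) \<midarrow>0\<rightarrow> a"
    by (simp add: DERIV_def)
  have "(\<lambda>s. ?f s / s) \<midarrow>0\<rightarrow> e"
  proof (rule LIM_zero_cancel, rule Lim_null_comparison)
    have "(\<lambda>s. \<bar>C\<bar> * \<bar>s\<bar>) \<midarrow>0\<rightarrow> \<bar>C\<bar> * \<bar>0\<bar>" by (intro tendsto_intros)
    then show "(\<lambda>s. \<bar>C\<bar> * \<bar>s\<bar>) \<midarrow>0\<rightarrow> 0" by simp
    have "norm (?f s / s - e) \<le> \<bar>C\<bar> * \<bar>s\<bar>" if "s \<noteq> 0" for s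
    proof -
      have "\<bar>?f s / s - e\<bar> = \<bar>?f s - s * e\<bar> / \<bar>s\<bar>"
        using that by (simp add: abs_divide[symmetric] diff_divide_distrib)
      also have "\<dots> \<le> \<bar>C\<bar> * s\<^sup>2 / \<bar>s\<bar>"
        by (intro divide_right_mono order_trans[OF Im] mult_right_mono) auto
      also have "\<dots> = \<bar>C\<bar> * \<bar>s\<bar>"
        unfolding power2_abs[of s, symmetric] power2_eq_square[of "\<bar>s\<bar>"]
        using that by (simp del: abs_mult_self_eq)
      finally show ?thesis by simp
    qed
    then show "\<forall>\<^sub>F s in at 0. norm (?f s / s - e) \<le> \<bar>C\<bar> * \<bar>s\<bar>"
      by (simp add: eventually_at_filter)
  qed
  with lim1 show ?thesis by (blast dest: LIM_unique)
qed

text \<open>Integrating |exp(ix) - 1 - ix| \<le> x^2/2 at x = \<open>s * X \<omega>\<close> gives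
  the quadratic error required by \<open>deriv_char_mean\<close>, with half the second moment of
  \<open>X\<close> as its constant.\<close>

lemma (in prob_space) expectation_from_gaussian_char:
  assumes X: "square_integrable M X"
    and char: "\<And>s. (\<integral>\<omega>. exp (\<i> * of_real (s * X \<omega>)) \<partial>M) = exp (\<i> * of_real (s * a) - of_real (s\<^sup>2 * v))"
  shows "expectation X = a"
proof (rule deriv_char_mean)
  fix s :: real
  note [measurable] = square_integrableD(1)[OF X]
  note sq = square_integrableD(2)[OF X]
  have int: "integrable M X" using square_integrable_imp_integrable[OF _ sq] by simp
  have intc: "integrable M (\<lambda>\<omega>. \<i> * of_real (s * X \<omega>))" using int by auto
  have inte: "integrable M (\<lambda>\<omega>. exp (\<i> * of_real (s * X \<omega>)))"
    by (rule integrable_const_bound[where B = 1]) auto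
  have "cmod (\<integral>\<omega>. exp (\<i> * of_real (s * X \<omega>)) - 1 - \<i> * of_real (s * X \<omega>) \<partial>M) \<le>
      (\<integral>\<omega>. s\<^sup>2 / 2 * (X \<omega>)\<^sup>2 \<partial>M)"
  proof (rule order_trans[OF integral_norm_bound integral_mono])
    show "cmod (exp (\<i> * of_real (s * X \<omega>)) - 1 - \<i> * of_real (s * X \<omega>)) \<le> s\<^sup>2 / 2 * (X \<omega>)\<^sup>2" for \<omega>
    proof -
      have "\<bar>s * X \<omega>\<bar> ^ Suc 1 / fact (Suc 1) = s\<^sup>2 / 2 * (X \<omega>)\<^sup>2"
        by (simp add: power_mult_distrib numeral_2_eq_2[symmetric])
      with iexp_approx1[of "s * X \<omega>" 1] show ?thesis by (simp add: diff_diff_eq)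
    qed
  qed (use inte intc sq in \<open>auto intro!: integrable_norm\<close>)
  also have "(\<integral>\<omega>. exp (\<i> * of_real (s * X \<omega>)) - 1 - \<i> * of_real (s * X \<omega>) \<partial>M) =
      exp (\<i> * of_real (s * a) - of_real (s\<^sup>2 * v)) - 1 - \<i> * of_real (s * expectation X)"
    using inte intc char[of s] by (simp add: prob_space)
  finally show "cmod (exp (\<i> * of_real (s * a) - of_real (s\<^sup>2 * v)) - 1 - \<i> * of_real (s * expectation X)) \<le>
      expectation (\<lambda>\<omega>. (X \<omega>)\<^sup>2) / 2 * s\<^sup>2"
    by (simp add: mult.commute)
qed

section \<open>Means and mean-square convergence\<close>

lemma (in prob_space) integrable_square_integrable:
  assumes "square_integrable M X"
  shows "integrable M X"
  using square_integrable_imp_integrable[of X] square_integrableD[OF assms] by simp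

text \<open>The variance is nonnegative.\<close>

lemma (in prob_space) square_expectation_le:
  assumes "square_integrable M X"
  shows "(expectation X)\<^sup>2 \<le> expectation (\<lambda>x. (X x)\<^sup>2)"
  using variance_positive[of X]
    variance_eq[OF integrable_square_integrable[OF assms] square_integrableD(2)[OF assms]]
  by simp

lemma (in prob_space) tendsto_expectation_square:
  assumes X: "\<And>n. square_integrable M (X n)" and Y: "square_integrable M Y"
    and lim: "(\<lambda>n. expectation (\<lambda>x. (X n x - Y x)\<^sup>2)) \<longlonglongrightarrow> 0"
  shows "(\<lambda>n. expectation (X n)) \<longlonglongrightarrow> expectation Y"
proof -
  have le: "(expectation (X n) - expectation Y)\<^sup>2 \<le> expectation (\<lambda>x. (X n x - Y x)\<^sup>2)" for n
    using square_expectation_le[OF square_integrable_diff[OF X[of n] Y]]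
    by (simp add: integrable_square_integrable X Y)
  have "(\<lambda>n. (expectation (X n) - expectation Y)\<^sup>2) \<longlonglongrightarrow> 0"
    by (rule tendsto_sandwich[OF _ _ tendsto_const lim]) (simp_all add: le)
  then have "(\<lambda>n. expectation (X n) - expectation Y) \<longlonglongrightarrow> 0"
    using tendsto_real_sqrt[of "\<lambda>n. (expectation (X n) - expectation Y)\<^sup>2" 0]
    by (simp add: tendsto_rabs_zero_iff)
  then show ?thesis by (rule LIM_zero_cancel)
qed

section \<open>The mean of the extended integral on pinned paths\<close>

context grid
begin

context
  fixes \<mu> \<nu> :: "wiener_space measure" and c :: "nat \<Rightarrow> real"
    and J :: "cameron_martin \<Rightarrow> wiener_space \<Rightarrow> real"
  assumes \<mu>: "wiener_measure \<mu>" and c0: "c 0 = 0"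
    and \<nu>: "conditioned_measure \<mu> (pinned m T c) \<nu>"
    and J: "extended_wiener_integral \<mu> \<nu> J"
begin

lemma prob_space_conditioned: "prob_space \<nu>"
  using \<nu> by (simp add: conditioned_measure_def)

lemma square_integrable_J: "square_integrable \<nu> (J h)"
  using J by (simp add: extended_wiener_integral_def)

lemma integrable_J: "integrable \<nu> (J h)"
  using prob_space.integrable_square_integrable[OF prob_space_conditioned square_integrable_J] .

lemma J_measurable [measurable]: "J h \<in> borel_measurable \<nu>"
  using square_integrable_J by (rule square_integrableD)

text \<open>The functional \<open>\<phi>\<close> is tied to \<open>h\<close> through
  \<open>\<mu>\<close>; its link with \<open>J h\<close> under \<open>\<nu>\<close> is the last
  clause of \<open>extended_wiener_integral\<close>. Continuity makes \<open>\<phi>\<close> Borel,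
  so square integrability and mean pass from \<open>J h\<close> to it.\<close>

lemma dual_version:
  assumes "is_dual_version \<mu> h \<phi>"
  shows "square_integrable \<nu> \<phi>" "(\<integral>\<omega>. \<phi> \<omega> \<partial>\<nu>) = (\<integral>\<omega>. J h \<omega> \<partial>\<nu>)"
proof -
  have [measurable]: "\<phi> \<in> borel_measurable \<nu>"
    using assms \<nu> by (auto intro: borel_measurable_bounded_linear simp: is_dual_version_def conditioned_measure_def)
  have eq: "AE \<omega> in \<nu>. J h \<omega> = \<phi> \<omega>"
    using assms J by (simp add: extended_wiener_integral_def)
  then have "integrable \<nu> (\<lambda>\<omega>. (\<phi> \<omega>)\<^sup>2) \<longleftrightarrow> integrable \<nu> (\<lambda>\<omega>. (J h \<omega>)\<^sup>2)"
    by (intro integrable_cong_AE) (auto elim: eventually_mono)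
  then show "square_integrable \<nu> \<phi>"
    using square_integrable_J[of h] by (simp add: square_integrable_def)
  show "(\<integral>\<omega>. \<phi> \<omega> \<partial>\<nu>) = (\<integral>\<omega>. J h \<omega> \<partial>\<nu>)"
    using eq by (intro integral_cong_AE) (auto elim: eventually_mono)
qed

lemma mean_J_kernel:
  assumes t: "0 \<le> t" "t \<le> 1"
  shows "(\<integral>\<omega>. J (kernel t) \<omega> \<partial>\<nu>) = inner (interpolant m T c) (kernel t)"
proof -
  interpret prob_space \<nu> by (rule prob_space_conditioned)
  have dual: "is_dual_version \<mu> (kernel t) (\<lambda>\<omega>. path_fun \<omega> t)"
    using is_dual_version_kernel[OF \<mu> t, of 1] by simp
  let ?P = "orth_proj (direction (pinned m T c))"
  have "expectation (\<lambda>\<omega>. path_fun \<omega> t) = inner (interpolant m T c) (kernel t)"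
  proof (rule expectation_from_gaussian_char)
    show "square_integrable \<nu> (\<lambda>\<omega>. path_fun \<omega> t)"
      by (rule dual_version[OF dual])
    fix s :: real
    have "(\<integral>\<omega>. exp (\<i> * of_real (s * path_fun \<omega> t)) \<partial>\<nu>) =
        exp (\<i> * of_real (inner (interpolant m T c) (s *\<^sub>R kernel t)) -
          of_real ((norm (?P (s *\<^sub>R kernel t)))\<^sup>2 / 2))"
      using \<nu> is_dual_version_kernel[OF \<mu> t, of s] nearest_to_0_pinned[of c, OF c0]
      unfolding conditioned_measure_def by metis
    \<comment> \<open>Homogeneity of the projection turns the exponent into the form
      \<open>s\<^sup>2 * v\<close> with \<open>v\<close> independent of \<open>s\<close>.\<close>
    also have "(norm (?P (s *\<^sub>R kernel t)))\<^sup>2 / 2 = s\<^sup>2 * ((norm (?P (kernel t)))\<^sup>2 / 2)"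
      by (simp add: orth_proj_pinned_scaleR[of c, OF c0] power_mult_distrib)
    finally show "(\<integral>\<omega>. exp (\<i> * of_real (s * path_fun \<omega> t)) \<partial>\<nu>) =
        exp (\<i> * of_real (s * inner (interpolant m T c) (kernel t)) -
          of_real (s\<^sup>2 * ((norm (?P (kernel t)))\<^sup>2 / 2)))"
      by simp
  qed
  then show ?thesis using dual_version(2)[OF dual] by simp
qed

lemma mean_J_add: "(\<integral>\<omega>. J (h + k) \<omega> \<partial>\<nu>) = (\<integral>\<omega>. J h \<omega> \<partial>\<nu>) + (\<integral>\<omega>. J k \<omega> \<partial>\<nu>)"
proof -
  have "(\<integral>\<omega>. J (h + k) \<omega> \<partial>\<nu>) = (\<integral>\<omega>. J h \<omega> + J k \<omega> \<partial>\<nu>)"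
    using J by (intro integral_cong_AE) (auto simp: extended_wiener_integral_def)
  then show ?thesis by (simp add: integrable_J)
qed

lemma mean_J_scaleR: "(\<integral>\<omega>. J (r *\<^sub>R h) \<omega> \<partial>\<nu>) = r * (\<integral>\<omega>. J h \<omega> \<partial>\<nu>)"
proof -
  have "(\<integral>\<omega>. J (r *\<^sub>R h) \<omega> \<partial>\<nu>) = (\<integral>\<omega>. r * J h \<omega> \<partial>\<nu>)"
    using J by (intro integral_cong_AE) (auto simp: extended_wiener_integral_def)
  then show ?thesis by simp
qed

lemma mean_J_step:
  "valid_steps p \<Longrightarrow> (\<integral>\<omega>. J (cm_step p) \<omega> \<partial>\<nu>) = inner (interpolant m T c) (cm_step p)"
proof (induction p)
  case Nil
  \<comment> \<open>The empty list gives the zero vector, whose mean is 0 by homogeneity with factor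
    0.\<close>
  then show ?case using mean_J_scaleR[of 0 0] by (simp add: cm_step_def)
next
  case (Cons x p)
  obtain a u v where x: "x = (a, u, v)" by (cases x)
  \<comment> \<open>Differences are written as sums with factor -1, since additivity and homogeneity
    are what \<open>J\<close> provides.\<close>
  have step: "cm_step (x # p) = a *\<^sub>R (kernel v + (-1) *\<^sub>R kernel u) + cm_step p"
    by (simp add: cm_step_def x)
  show ?case
    unfolding step mean_J_add mean_J_scaleR inner_add_right inner_scaleR_right
    using Cons by (simp add: x mean_J_kernel)
qed

theorem mean_J: "(\<integral>\<omega>. J h \<omega> \<partial>\<nu>) = inner (interpolant m T c) h"
proof -
  interpret prob_space \<nu> by (rule prob_space_conditioned)
  obtain p where p: "\<And>n. valid_steps (p n)" "(\<lambda>n. cm_step (p n)) \<longlonglongrightarrow> h"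
    using cm_step_dense by blast
  have "(\<lambda>n. expectation (J (cm_step (p n)))) \<longlonglongrightarrow> expectation (J h)"
    using J p(2) by (intro tendsto_expectation_square square_integrable_J)
      (simp add: extended_wiener_integral_def)
  moreover have "(\<lambda>n. expectation (J (cm_step (p n)))) \<longlonglongrightarrow> inner (interpolant m T c) h"
    unfolding mean_J_step[OF p(1)] by (intro tendsto_intros p(2))
  ultimately show ?thesis by (rule LIMSEQ_unique)
qed

end

end

text \<open>That the pinned set is nonempty, closed and affine confirms that its nearest point and
  direction space have their intended meaning. Integrability of \<open>\<phi>\<close> rules out that
  the transform is merely the default value of an undefined integral.\<close>

theorem mainTheorem3:
  fixes \<mu> \<nu> :: "wiener_space measure"
    and m :: nat and T c :: "nat \<Rightarrow> real"
    and J :: "cameron_martin \<Rightarrow> wiener_space \<Rightarrow> real"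
    and h :: cameron_martin
  assumes "wiener_measure \<mu>"
    and "1 \<le> m" and "0 < T 1" and "\<forall>k\<in>{1..<m}. T k < T (Suc k)" and "T m \<le> 1"
    and "conditioned_measure \<mu> (pinned m T c) \<nu>"
    and "extended_wiener_integral \<mu> \<nu> J"
  shows "pinned m T c \<noteq> {} \<and> closed (pinned m T c) \<and> affine (pinned m T c) \<and>
    (\<integral>\<omega>. J h \<omega> \<partial>\<nu>) =
      c 1 / T 1 * (LINT t:{0..T 1}|lebesgue. cm_deriv h t) +
      (\<Sum>k=2..m. (c k - c (k - 1)) / (T k - T (k - 1)) *
        (LINT t:{T (k - 1)..T k}|lebesgue. cm_deriv h t)) \<and>
    (\<forall>\<phi>. is_dual_version \<mu> h \<phi> \<longrightarrow> integrable \<nu> \<phi> \<and>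
      gaussian_radon_transform \<nu> \<phi> =
        c 1 / T 1 * (LINT t:{0..T 1}|lebesgue. cm_deriv h t) +
        (\<Sum>k=2..m. (c k - c (k - 1)) / (T k - T (k - 1)) *
          (LINT t:{T (k - 1)..T k}|lebesgue. cm_deriv h t)))"
proof -
  \<comment> \<open>The values of \<open>T\<close> and \<open>c\<close> at index 0 are arbitrary in
    the statement. Resetting them to 0 leaves the pinned set unchanged, as its conditions start at
    index 1, and makes 0 the left endpoint of the first cell.\<close>
  define T' where "T' = T(0 := 0)"
  define c' where "c' = c(0 := 0)"
  have c'0: "c' 0 = 0" by (simp add: c'_def)
  interpret grid m T'
  proof
    show "T' k < T' (Suc k)" if "k < m" for k
      using assms(3,4) that by (cases "k = 0") (auto simp: T'_def)
  qed (use assms in \<open>auto simp: T'_def\<close>)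
  have pinned: "pinned m T c = pinned m T' c'"
    by (auto simp: pinned_def T'_def c'_def)
  have \<nu>: "conditioned_measure \<mu> (pinned m T' c') \<nu>"
    using assms(6) by (simp add: pinned)
  let ?R = "c 1 / T 1 * (LINT t:{0..T 1}|lebesgue. cm_deriv h t) +
      (\<Sum>k=2..m. (c k - c (k - 1)) / (T k - T (k - 1)) *
        (LINT t:{T (k - 1)..T k}|lebesgue. cm_deriv h t))"
  have L: "cm_fun h (T' k) - cm_fun h (T' (k - 1)) = (LINT t:{T' (k - 1)..T' k}|lebesgue. cm_deriv h t)"
    if "k \<in> {1..m}" for k
    using that by (intro set_integral_cm_deriv[symmetric] T_range T_mono) auto
  have "inner (interpolant m T' c') h =
      (\<Sum>k=1..m. (c' k - c' (k - 1)) / (T' k - T' (k - 1)) *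
        (LINT t:{T' (k - 1)..T' k}|lebesgue. cm_deriv h t))"
    unfolding inner_interpolant by (intro sum.cong refl) (simp only: L)
  also have "\<dots> = ?R"
    \<comment> \<open>Splitting off the term at index 1 produces the quotient
      \<open>c 1 / T 1\<close> and the interval from 0 to \<open>T 1\<close>; the remaining terms
      involve only unaltered values.\<close>
    using assms(2) unfolding sum.atLeast_Suc_atMost[OF assms(2)]
    by (intro arg_cong2[where f = "(+)"] sum.cong) (auto simp: T'_def c'_def numeral_2_eq_2)
  finally have mean: "(\<integral>\<omega>. J h \<omega> \<partial>\<nu>) = ?R"
    using mean_J[OF assms(1) c'0 \<nu> assms(7), of h] by simp
  note dual = dual_version[OF assms(1) c'0 \<nu> assms(7), of h]
  have "integrable \<nu> \<phi> \<and> gaussian_radon_transform \<nu> \<phi> = ?R" if "is_dual_version \<mu> h \<phi>" for \<phi>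
    using prob_space.integrable_square_integrable[OF _ dual(1)[OF that]] dual(2)[OF that] mean \<nu>
    by (simp add: gaussian_radon_transform_def conditioned_measure_def)
  moreover have "pinned m T c \<noteq> {}" "closed (pinned m T c)" "affine (pinned m T c)"
    using interpolant_in_pinned[of c', OF c'0] closed_pinned[of c'] affine_pinned[of c']
    by (auto simp: pinned)
  ultimately show ?thesis using mean by blast
qed

end
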